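(* For all integers $k\ge2$ and $m\ge1$, the $q,t$-Fu\ss-Catalan numbers of the dihedral group $I_2(k)$ are $$\operatorname{Cat}^{(m)}(I_2(k);q,t)=\sum_{j=0}^m q^{m-j}t^{m-j}[jk+1]_{q,t}.$$
   Context: $I_2(k)$ is the dihedral group of order $2k$ acting as a real reflection group on $\mathbb{C}^2$, identically on the variables $(x_1,x_2)$ and $(y_1,y_2)$ of $\mathbb{C}[\mathbf{x},\mathbf{y}]$. $\mathcal{A}$ is the ideal generated by all polynomials $p$ with $\omega(p)=\det(\omega)p$ for all $\omega$, and $\operatorname{Cat}^{(m)}(W;q,t)=\sum_{i,j}\dim(M_{i,j})q^it^j$ for $M=\mathcal{A}^m/\langle\mathbf{x},\mathbf{y}\rangle\mathcal{A}^m$, bigraded by ($\mathbf{x}$-degree, $\mathbf{y}$-degree), with $\langle\mathbf{x},\mathbf{y}\rangle$ the ideal of polynomials without constant term. $[n]_{q,t}=(q^n-t^n)/(q-t)$. *)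

theory Defs
  imports Complex_Main "HOL-Computational_Algebra.Polynomial"
begin

text \<open>Polynomials in C[x1,x2,y1,y2] are represented as polynomial functions on C^4
  (faithful since C is infinite). A point is ((x1,x2),(y1,y2)).\<close>

type_synonym pt = "(complex \<times> complex) \<times> (complex \<times> complex)"

definition mono :: "nat \<times> nat \<times> nat \<times> nat \<Rightarrow> pt \<Rightarrow> complex" where
  "mono e z = (case e of (a,b,c,d) \<Rightarrow> case z of ((x1,x2),(y1,y2)) \<Rightarrow>
      x1^a * x2^b * y1^c * y2^d)"

definition poly_fun :: "(pt \<Rightarrow> complex) \<Rightarrow> bool" where
  "poly_fun f \<longleftrightarrow> (\<exists>S c. finite S \<and> f = (\<lambda>z. \<Sum>e\<in>S. c e * mono e z))"

text \<open>2x2 real matrices (a,b,c,d) = [[a,b],[c,d]].\<close>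
type_synonym mat2 = "real \<times> real \<times> real \<times> real"

definition det2 :: "mat2 \<Rightarrow> real" where
  "det2 M = (case M of (a,b,c,d) \<Rightarrow> a*d - b*c)"

definition inv2 :: "mat2 \<Rightarrow> mat2" where
  "inv2 M = (case M of (a,b,c,d) \<Rightarrow>
     (d / det2 M, - b / det2 M, - c / det2 M, a / det2 M))"

definition lin2 :: "mat2 \<Rightarrow> complex \<times> complex \<Rightarrow> complex \<times> complex" where
  "lin2 M v = (case M of (a,b,c,d) \<Rightarrow> case v of (v1,v2) \<Rightarrow>
     (of_real a * v1 + of_real b * v2, of_real c * v1 + of_real d * v2))"

definition act :: "mat2 \<Rightarrow> (pt \<Rightarrow> complex) \<Rightarrow> pt \<Rightarrow> complex" where
  "act w p = (\<lambda>(x,y). p (lin2 (inv2 w) x, lin2 (inv2 w) y))"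

definition rot :: "nat \<Rightarrow> nat \<Rightarrow> mat2" where
  "rot k j = (let th = 2 * pi * real j / real k in (cos th, - sin th, sin th, cos th))"

definition refl :: "nat \<Rightarrow> nat \<Rightarrow> mat2" where
  "refl k j = (let th = 2 * pi * real j / real k in (cos th, sin th, sin th, - cos th))"

definition dihedral :: "nat \<Rightarrow> mat2 set" where
  "dihedral k = {rot k j | j. j < k} \<union> {refl k j | j. j < k}"

definition alternant :: "mat2 set \<Rightarrow> (pt \<Rightarrow> complex) \<Rightarrow> bool" where
  "alternant W p \<longleftrightarrow> poly_fun p \<and>
     (\<forall>w\<in>W. act w p = (\<lambda>z. complex_of_real (det2 w) * p z))"

definition gen_ideal :: "(pt \<Rightarrow> complex) set \<Rightarrow> (pt \<Rightarrow> complex) set" where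
  "gen_ideal G = {f. \<exists>(n::nat) r g. (\<forall>i<n. poly_fun (r i) \<and> g i \<in> G) \<and>
                         f = (\<lambda>z. \<Sum>i<n. r i z * g i z)}"

definition ideal_prod :: "(pt \<Rightarrow> complex) set \<Rightarrow> (pt \<Rightarrow> complex) set \<Rightarrow> (pt \<Rightarrow> complex) set" where
  "ideal_prod I J = gen_ideal {(\<lambda>z. f z * g z) | f g. f \<in> I \<and> g \<in> J}"

primrec ideal_pow :: "(pt \<Rightarrow> complex) set \<Rightarrow> nat \<Rightarrow> (pt \<Rightarrow> complex) set" where
  "ideal_pow I 0 = {f. poly_fun f}"
| "ideal_pow I (Suc n) = ideal_prod I (ideal_pow I n)"

definition alt_ideal :: "mat2 set \<Rightarrow> (pt \<Rightarrow> complex) set" where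
  "alt_ideal W = gen_ideal {p. alternant W p}"

definition max_ideal :: "(pt \<Rightarrow> complex) set" where
  "max_ideal = gen_ideal {mono (1,0,0,0), mono (0,1,0,0), mono (0,0,1,0), mono (0,0,0,1)}"

definition bihom :: "nat \<Rightarrow> nat \<Rightarrow> (pt \<Rightarrow> complex) \<Rightarrow> bool" where
  "bihom i j f \<longleftrightarrow> (\<forall>s t x1 x2 y1 y2.
     f ((s*x1, s*x2), (t*y1, t*y2)) = s^i * t^j * f ((x1,x2),(y1,y2)))"

definition cspan :: "(pt \<Rightarrow> complex) set \<Rightarrow> (pt \<Rightarrow> complex) set" where
  "cspan S = {f. \<exists>(n::nat) c g. (\<forall>i<n. g i \<in> S) \<and> f = (\<lambda>z. \<Sum>i<n. c i * g i z)}"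

text \<open>Complex dimension of the quotient V/U (U a subspace of V).\<close>
definition qdim :: "(pt \<Rightarrow> complex) set \<Rightarrow> (pt \<Rightarrow> complex) set \<Rightarrow> nat" where
  "qdim V U = (LEAST n. \<exists>S. finite S \<and> card S = n \<and> S \<subseteq> V \<and>
      V \<subseteq> {(\<lambda>z. s z + u z) | s u. s \<in> cspan S \<and> u \<in> U})"

definition Mdim :: "mat2 set \<Rightarrow> nat \<Rightarrow> nat \<Rightarrow> nat \<Rightarrow> nat" where
  "Mdim W m i j = qdim {f \<in> ideal_pow (alt_ideal W) m. bihom i j f}
                       {f \<in> ideal_prod max_ideal (ideal_pow (alt_ideal W) m). bihom i j f}"

definition qv :: "int poly poly" where "qv = monom 1 1"
definition tv :: "int poly poly" where "tv = [: monom 1 1 :]"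

definition qt_int :: "nat \<Rightarrow> int poly poly" where
  "qt_int n = (THE P. (qv - tv) * P = qv ^ n - tv ^ n)"

end

theory Submission
  imports Defs "HOL-Library.Function_Algebras"
begin

text \<open>In the coordinates \<open>zx = x1 + i x2\<close>, \<open>wx = x1 - i x2\<close> (and \<open>zy\<close>, \<open>wy\<close> likewise) the
  rotations are diagonal and the reflections swap \<open>z\<close> and \<open>w\<close> up to roots of unity. Averaging over
  the group and reducing modulo \<open>Delta = zx wy - wx zy\<close> shows that the alternants generate the same
  ideal \<open>A\<close> as \<open>Delta\<close> and \<open>g\<^sub>i = zx^(k-i) zy^i - wx^(k-i) wy^i\<close> for \<open>0 \<le> i \<le> k\<close>. Since
  \<open>g\<^sub>i g\<^sub>l - g\<^sub>i' g\<^sub>l'\<close> lies in \<open>Delta A\<close> whenever \<open>i + l = i' + l'\<close>, a product of \<open>j\<close> of the \<open>g\<^sub>i\<close>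
  matters only through its index sum \<open>s\<close>, so \<open>A^m\<close> is generated by elements \<open>Delta^(m-j) G(j,s)\<close>
  with \<open>j \<le> m\<close> and \<open>s \<le> j k\<close>. These are minimal generators: \<open>Delta^(m-j) G(j,s)\<close> has total degree
  \<open>2m + j(k-2)\<close>, so a relation modulo \<open>\<langle>x,y\<rangle> A^m\<close> whose largest index is \<open>j\<close> involves beyond its
  leading term only multiples of \<open>Delta^(m-j+1)\<close>, whereas \<open>G(j,s)\<close> does not vanish identically
  on \<open>Delta = 0\<close>.\<close>

section \<open>Polynomial functions, spans and ideals\<close>

lemma sum_fun_apply: "(\<Sum>i\<in>A. f i) x = (\<Sum>i\<in>A. f i x)"
  for f :: "'i \<Rightarrow> 'a \<Rightarrow> 'b::comm_monoid_add"
  by (induction A rule: infinite_finite_induct) auto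

lemma power_fun_apply: "(f ^ n) x = f x ^ n"
  for f :: "'a \<Rightarrow> 'b::monoid_mult"
  by (induction n) auto

text \<open>Scalars are embedded as constant functions, so that scaling becomes multiplication in
  the pointwise ring of functions and ring identities apply to it.\<close>

definition konst :: "complex \<Rightarrow> pt \<Rightarrow> complex" where
  "konst c = (\<lambda>_. c)"

lemma konst_apply [simp]: "konst c z = c"
  by (simp add: konst_def)

interpretation fs: vector_space "\<lambda>(c::complex) (f::pt \<Rightarrow> complex). konst c * f"
  by standard (auto simp: fun_eq_iff algebra_simps)

lemma cspan_altdef: "cspan S = {f. \<exists>(n::nat) c g. (\<forall>i<n. g i \<in> S) \<and> f = (\<Sum>i<n. konst (c i) * g i)}"
  by (simp add: cspan_def fun_eq_iff sum_fun_apply)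

lemma gen_ideal_altdef: "gen_ideal G = {f. \<exists>(n::nat) r g. (\<forall>i<n. poly_fun (r i) \<and> g i \<in> G) \<and> f = (\<Sum>i<n. r i * g i)}"
  by (simp add: gen_ideal_def fun_eq_iff sum_fun_apply)

text \<open>Concatenation of two families indexed by initial segments; it gives closure under
  addition both for \<open>cspan\<close> and for \<open>gen_ideal\<close>.\<close>

lemma sum_append_nat:
  fixes f g :: "nat \<Rightarrow> 'a::comm_monoid_add"
  shows "(\<Sum>i<m + n. if i < m then f i else g (i - m)) = (\<Sum>i<m. f i) + (\<Sum>i<n. g i)"
  by (induction n) (auto simp: add.assoc)

lemma cspan_eq_span: "cspan S = fs.span S"
proof (rule set_eqI, rule iffI)
  fix f assume "f \<in> cspan S"
  then show "f \<in> fs.span S"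
    unfolding cspan_altdef by (auto intro!: fs.span_sum fs.span_scale intro: fs.span_base)
next
  have sub: "fs.subspace (cspan S)"
  proof (rule fs.subspaceI)
    show "0 \<in> cspan S"
      unfolding cspan_altdef by (intro CollectI exI[of _ 0]) auto
  next
    fix x y assume "x \<in> cspan S" "y \<in> cspan S"
    then obtain m c g n c' g' where
      *: "\<forall>i<(m::nat). g i \<in> S" "x = (\<Sum>i<m. konst (c i) * g i)"
         "\<forall>i<(n::nat). g' i \<in> S" "y = (\<Sum>i<n. konst (c' i) * g' i)"
      unfolding cspan_altdef by blast
    have "x + y = (\<Sum>i<m + n. if i < m then konst (c i) * g i else konst (c' (i - m)) * g' (i - m))"
      unfolding * by (rule sum_append_nat[symmetric])
    also have "\<dots> = (\<Sum>i<m + n. konst (if i < m then c i else c' (i - m)) * (if i < m then g i else g' (i - m)))"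
      by (intro sum.cong) auto
    finally show "x + y \<in> cspan S"
      unfolding cspan_altdef using *
      by (intro CollectI exI[of _ "m + n"] exI[of _ "\<lambda>i. if i < m then c i else c' (i - m)"]
            exI[of _ "\<lambda>i. if i < m then g i else g' (i - m)"]) auto
  next
    fix a x assume "x \<in> cspan S"
    then obtain m c g where *: "\<forall>i<(m::nat). g i \<in> S" "x = (\<Sum>i<m. konst (c i) * g i)"
      unfolding cspan_altdef by blast
    have "konst a * x = (\<Sum>i<m. konst (a * c i) * g i)"
      unfolding * by (simp add: fun_eq_iff sum_fun_apply sum_distrib_left mult.assoc)
    with * show "konst a * x \<in> cspan S"
      unfolding cspan_altdef by (intro CollectI exI[of _ m] exI[of _ "\<lambda>i. a * c i"] exI[of _ g]) auto
  qed
  have "S \<subseteq> cspan S"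
  proof
    fix x assume "x \<in> S"
    then show "x \<in> cspan S" unfolding cspan_altdef
      by (intro CollectI exI[of _ 1] exI[of _ "\<lambda>_. 1"] exI[of _ "\<lambda>_. x"]) (auto simp: fun_eq_iff)
  qed
  fix f assume "f \<in> fs.span S"
  with fs.span_minimal[OF \<open>S \<subseteq> cspan S\<close> sub] show "f \<in> cspan S" by blast
qed

lemma mono_mult: "mono (a,b,c,d) * mono (a',b',c',d') = mono (a+a',b+b',c+c',d+d')"
  by (simp add: fun_eq_iff mono_def power_add)

lemma poly_fun_iff_span: "poly_fun f \<longleftrightarrow> f \<in> fs.span (range mono)"
proof
  assume "poly_fun f"
  then obtain S c where "finite S" and f: "f = (\<lambda>z. \<Sum>e\<in>S. c e * mono e z)"
    unfolding poly_fun_def by blast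
  have "f = (\<Sum>e\<in>S. konst (c e) * mono e)"
    by (simp add: f fun_eq_iff sum_fun_apply)
  then show "f \<in> fs.span (range mono)"
    by (auto intro!: fs.span_sum fs.span_scale intro: fs.span_base)
next
  assume "f \<in> fs.span (range mono)"
  then show "poly_fun f"
  proof (induction rule: fs.span_induct_alt)
    case base
    show ?case unfolding poly_fun_def
      by (intro exI[of _ "{}"]) (auto simp: fun_eq_iff)
  next
    case (step a m f)
    then obtain e S c where m: "m = mono e" and S: "finite S" and f: "f = (\<lambda>z. \<Sum>e\<in>S. c e * mono e z)"
      unfolding poly_fun_def by blast
    \<comment> \<open>The values of \<open>c\<close> outside \<open>S\<close> are arbitrary, so they
      are replaced by zero before \<open>a\<close> is added at \<open>e\<close>, which may or may
      not lie in \<open>S\<close>.\<close>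
    let ?c = "\<lambda>x. (if x \<in> S then c x else 0) + (if x = e then a else 0)"
    have "konst a * m + f = (\<lambda>z. \<Sum>x\<in>insert e S. ?c x * mono x z)"
    proof
      fix z
      have "(\<Sum>x\<in>insert e S. ?c x * mono x z)
        = (\<Sum>x\<in>insert e S. (if x \<in> S then c x else 0) * mono x z) + (\<Sum>x\<in>insert e S. (if x = e then a else 0) * mono x z)"
        by (simp only: distrib_right sum.distrib)
      also have "(\<Sum>x\<in>insert e S. (if x \<in> S then c x else 0) * mono x z) = f z"
        unfolding f using S by (intro sum.mono_neutral_cong_right) auto
      also have "(\<Sum>x\<in>insert e S. (if x = e then a else 0) * mono x z) = a * m z"
        using S by (simp add: m if_distrib[of "\<lambda>x. x * _"] cong: if_cong)
      finally show "(konst a * m + f) z = (\<Sum>x\<in>insert e S. ?c x * mono x z)" by simp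
    qed
    with S show ?case unfolding poly_fun_def
      by (intro exI[of _ "insert e S"] exI[of _ ?c] conjI) (rule finite.insertI)
  qed
qed

section \<open>Closure properties of polynomial functions\<close>

lemma poly_fun_mono: "poly_fun (mono e)"
  by (auto simp: poly_fun_iff_span intro: fs.span_base)

lemma poly_fun_add: "poly_fun f \<Longrightarrow> poly_fun g \<Longrightarrow> poly_fun (f + g)"
  by (simp add: poly_fun_iff_span fs.span_add)

lemma poly_fun_diff: "poly_fun f \<Longrightarrow> poly_fun g \<Longrightarrow> poly_fun (f - g)"
  by (simp add: poly_fun_iff_span fs.span_diff)

lemma konst_eq_mono: "konst c = konst c * mono (0,0,0,0)"
  by (simp add: fun_eq_iff mono_def)

lemma poly_fun_konst: "poly_fun (konst c)"
  by (subst konst_eq_mono) (auto simp: poly_fun_iff_span intro!: fs.span_scale intro: fs.span_base)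

lemma poly_fun_0: "poly_fun 0" and poly_fun_1: "poly_fun 1"
  using poly_fun_konst[of 0] poly_fun_konst[of 1] by (simp_all add: konst_def zero_fun_def one_fun_def)

lemma poly_fun_uminus: "poly_fun f \<Longrightarrow> poly_fun (- f)"
  by (simp add: poly_fun_iff_span fs.span_neg)

text \<open>Bilinearity: two nested inductions over the spans reduce a product to products of
  spanning elements.\<close>

lemma span_mult:
  assumes "f \<in> fs.span S" "g \<in> fs.span T" "fs.subspace V"
    and "\<And>s t. s \<in> S \<Longrightarrow> t \<in> T \<Longrightarrow> s * t \<in> V"
  shows "f * g \<in> V"
  using assms(1)
proof (induction rule: fs.span_induct_alt)
  case base
  show ?case using fs.subspace_0[OF assms(3)] by (simp only: mult_zero_left)
next
  case (step c s f)
  have "s * g \<in> V" using assms(2)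
  proof (induction rule: fs.span_induct_alt)
    case base
    show ?case using fs.subspace_0[OF assms(3)] by (simp only: mult_zero_right)
  next
    case (step c' t g)
    have "s * (konst c' * t + g) = konst c' * (s * t) + s * g"
      by (simp only: algebra_simps)
    moreover have "konst c' * (s * t) + s * g \<in> V"
      using step \<open>s \<in> S\<close> assms(3,4) fs.subspace_add fs.subspace_scale by blast
    ultimately show ?case by (simp only:)
  qed
  have "(konst c * s + f) * g = konst c * (s * g) + f * g"
    by (simp only: algebra_simps)
  moreover have "konst c * (s * g) + f * g \<in> V"
    using \<open>s * g \<in> V\<close> step assms(3) fs.subspace_add fs.subspace_scale by blast
  ultimately show ?case by (simp only:)
qed

lemma poly_fun_mult:
  assumes "poly_fun f" "poly_fun g" shows "poly_fun (f * g)"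
proof -
  have "fs.subspace {f. poly_fun f}" by (simp add: poly_fun_iff_span)
  moreover have "mono e * mono e' \<in> {f. poly_fun f}" for e e'
    by (cases e; cases e') (simp add: mono_mult poly_fun_mono)
  ultimately have "f * g \<in> {f. poly_fun f}"
    using assms unfolding poly_fun_iff_span
    by (intro span_mult[of f "range mono" g "range mono"]) auto
  then show ?thesis by simp
qed

lemma poly_fun_power: "poly_fun f \<Longrightarrow> poly_fun (f ^ n)"
  by (induction n) (auto intro: poly_fun_1 poly_fun_mult)

lemma poly_fun_sum: "(\<And>i. i \<in> A \<Longrightarrow> poly_fun (f i)) \<Longrightarrow> poly_fun (\<Sum>i\<in>A. f i)"
  by (induction A rule: infinite_finite_induct) (auto intro: poly_fun_0 poly_fun_add)

text \<open>Only the multipliers have to be polynomial; the members may be arbitrary functions, so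
  that colon-type sets such as \<open>{f. f * h \<in> I}\<close> qualify without further
  conditions.\<close>

definition poly_ideal :: "(pt \<Rightarrow> complex) set \<Rightarrow> bool" where
  "poly_ideal I \<longleftrightarrow> 0 \<in> I \<and> (\<forall>f\<in>I. \<forall>g\<in>I. f + g \<in> I) \<and> (\<forall>r f. poly_fun r \<longrightarrow> f \<in> I \<longrightarrow> r * f \<in> I)"

lemma poly_idealD:
  assumes "poly_ideal I"
  shows poly_ideal_0: "0 \<in> I"
    and poly_ideal_add: "f \<in> I \<Longrightarrow> g \<in> I \<Longrightarrow> f + g \<in> I"
    and poly_ideal_mult: "poly_fun r \<Longrightarrow> f \<in> I \<Longrightarrow> r * f \<in> I"
  using assms by (auto simp: poly_ideal_def)

lemma poly_ideal_uminus: "poly_ideal I \<Longrightarrow> f \<in> I \<Longrightarrow> - f \<in> I"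
  using poly_ideal_mult[of I "- 1" f] by (simp add: poly_fun_uminus poly_fun_1)

lemma poly_ideal_diff: "poly_ideal I \<Longrightarrow> f \<in> I \<Longrightarrow> g \<in> I \<Longrightarrow> f - g \<in> I"
  using poly_ideal_add[of I f "- g"] by (simp add: poly_ideal_uminus)

lemma poly_ideal_sum: "poly_ideal I \<Longrightarrow> (\<And>i. i \<in> A \<Longrightarrow> f i \<in> I) \<Longrightarrow> (\<Sum>i\<in>A. f i) \<in> I"
  by (induction A rule: infinite_finite_induct) (auto intro: poly_idealD)

lemma poly_ideal_gen_ideal: "poly_ideal (gen_ideal S)"
  unfolding poly_ideal_def
proof (intro conjI ballI allI impI)
  show "0 \<in> gen_ideal S"
    unfolding gen_ideal_altdef by (intro CollectI exI[of _ 0]) auto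
next
  fix x y assume "x \<in> gen_ideal S" "y \<in> gen_ideal S"
  then obtain m c g n c' g' where
    *: "\<forall>i<(m::nat). poly_fun (c i) \<and> g i \<in> S" "x = (\<Sum>i<m. c i * g i)"
       "\<forall>i<(n::nat). poly_fun (c' i) \<and> g' i \<in> S" "y = (\<Sum>i<n. c' i * g' i)"
    unfolding gen_ideal_altdef by blast
  have "x + y = (\<Sum>i<m + n. if i < m then c i * g i else c' (i - m) * g' (i - m))"
    unfolding * by (rule sum_append_nat[symmetric])
  also have "\<dots> = (\<Sum>i<m + n. (if i < m then c i else c' (i - m)) * (if i < m then g i else g' (i - m)))"
    by (intro sum.cong) auto
  finally show "x + y \<in> gen_ideal S"
    unfolding gen_ideal_altdef using *
    by (intro CollectI exI[of _ "m + n"] exI[of _ "\<lambda>i. if i < m then c i else c' (i - m)"]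
          exI[of _ "\<lambda>i. if i < m then g i else g' (i - m)"]) auto
next
  fix a x assume "poly_fun a" "x \<in> gen_ideal S"
  then obtain m c g where *: "\<forall>i<(m::nat). poly_fun (c i) \<and> g i \<in> S" "x = (\<Sum>i<m. c i * g i)"
    unfolding gen_ideal_altdef by blast
  have "a * x = (\<Sum>i<m. (a * c i) * g i)"
    unfolding * by (simp add: sum_distrib_left mult.assoc)
  with * \<open>poly_fun a\<close> show "a * x \<in> gen_ideal S"
    unfolding gen_ideal_altdef
    by (intro CollectI exI[of _ m] exI[of _ "\<lambda>i. a * c i"] exI[of _ g]) (auto intro: poly_fun_mult)
qed

lemma gen_ideal_base: "x \<in> S \<Longrightarrow> x \<in> gen_ideal S"
  unfolding gen_ideal_altdef
  by (intro CollectI exI[of _ 1] exI[of _ "\<lambda>_. 1"] exI[of _ "\<lambda>_. x"]) (auto intro: poly_fun_1)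

lemma gen_ideal_least: "poly_ideal I \<Longrightarrow> S \<subseteq> I \<Longrightarrow> gen_ideal S \<subseteq> I"
  unfolding gen_ideal_altdef by (auto intro!: poly_ideal_sum poly_ideal_mult)

text \<open>The colon ideal of \<open>I\<close> by \<open>h\<close>. With one factor fixed, a claim
  about products becomes an inclusion of ideals, which can be checked on generators.\<close>

lemma poly_ideal_vimage_mult: "poly_ideal I \<Longrightarrow> poly_ideal {f. f * h \<in> I}"
  by (auto simp: poly_ideal_def distrib_right mult.assoc)

lemma poly_ideal_image_mult: "poly_ideal I \<Longrightarrow> poly_ideal {h * f | f. f \<in> I}"
  unfolding poly_ideal_def
proof (safe, goal_cases)
  case 1
  then show ?case by (intro exI[of _ 0]) simp
next
  case (2 _ _ f g)
  then show ?case by (intro exI[of _ "f + g"]) (simp add: distrib_left)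
next
  case (3 r _ f)
  then show ?case by (intro exI[of _ "r * f"]) (simp add: mult.left_commute)
qed

lemma ideal_prod_mult: "f \<in> I \<Longrightarrow> g \<in> J \<Longrightarrow> f * g \<in> ideal_prod I J"
  unfolding ideal_prod_def by (rule gen_ideal_base) (auto simp: times_fun_def)

lemma ideal_prod_least:
  assumes "poly_ideal K" "\<And>f g. f \<in> I \<Longrightarrow> g \<in> J \<Longrightarrow> f * g \<in> K"
  shows "ideal_prod I J \<subseteq> K"
  unfolding ideal_prod_def using assms by (intro gen_ideal_least) (auto simp: times_fun_def)

lemma ideal_prod_gen_ideal_least:
  assumes "poly_ideal K" "\<And>f g. f \<in> S \<Longrightarrow> g \<in> T \<Longrightarrow> f * g \<in> K"
  shows "ideal_prod (gen_ideal S) (gen_ideal T) \<subseteq> K"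
proof (rule ideal_prod_least[OF assms(1)])
  fix f g assume f: "f \<in> gen_ideal S" and g: "g \<in> gen_ideal T"
  have "S \<subseteq> {f. f * g \<in> K}"
  proof
    fix f assume "f \<in> S"
    with assms(2) have "T \<subseteq> {g. g * f \<in> K}" by (auto simp: mult.commute[of _ f])
    from subsetD[OF gen_ideal_least[OF poly_ideal_vimage_mult[OF assms(1)] this] g]
    show "f \<in> {f. f * g \<in> K}" by (simp add: mult.commute)
  qed
  from subsetD[OF gen_ideal_least[OF poly_ideal_vimage_mult[OF assms(1)] this] f]
  show "f * g \<in> K" by simp
qed

lemma poly_ideal_ideal_prod: "poly_ideal (ideal_prod I J)"
  unfolding ideal_prod_def by (rule poly_ideal_gen_ideal)

lemma poly_ideal_ideal_pow: "poly_ideal (ideal_pow I n)"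
  by (cases n) (auto simp: poly_ideal_ideal_prod, auto simp: poly_ideal_def intro: poly_fun_0 poly_fun_add poly_fun_mult)

section \<open>The ideal generated by the alternants\<close>

definition zx :: "pt \<Rightarrow> complex" where "zx = (\<lambda>((x1,x2),(y1,y2)). x1 + \<i> * x2)"
definition wx :: "pt \<Rightarrow> complex" where "wx = (\<lambda>((x1,x2),(y1,y2)). x1 - \<i> * x2)"
definition zy :: "pt \<Rightarrow> complex" where "zy = (\<lambda>((x1,x2),(y1,y2)). y1 + \<i> * y2)"
definition wy :: "pt \<Rightarrow> complex" where "wy = (\<lambda>((x1,x2),(y1,y2)). y1 - \<i> * y2)"

text \<open>The exponents belong to \<open>zx\<close>, \<open>wx\<close>, \<open>zy\<close>,
  \<open>wy\<close> in this order. Swapping \<open>z\<close> and \<open>w\<close> thus sends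
  \<open>(a,b,c,d)\<close> to \<open>(b,a,d,c)\<close>, and rotations act through the weight
  \<open>(a + c) - (b + d)\<close>.\<close>

definition zmono :: "nat \<Rightarrow> nat \<Rightarrow> nat \<Rightarrow> nat \<Rightarrow> pt \<Rightarrow> complex" where
  "zmono a b c d = zx ^ a * wx ^ b * zy ^ c * wy ^ d"

definition zmonos :: "(pt \<Rightarrow> complex) set" where
  "zmonos = {zmono a b c d | a b c d. True}"

lemma poly_fun_coords: "poly_fun zx" "poly_fun wx" "poly_fun zy" "poly_fun wy"
proof -
  have eqs: "zx = mono (1,0,0,0) + konst \<i> * mono (0,1,0,0)" "wx = mono (1,0,0,0) - konst \<i> * mono (0,1,0,0)"
    "zy = mono (0,0,1,0) + konst \<i> * mono (0,0,0,1)" "wy = mono (0,0,1,0) - konst \<i> * mono (0,0,0,1)"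
    by (auto simp: fun_eq_iff zx_def wx_def zy_def wy_def mono_def)
  show "poly_fun zx" "poly_fun wx" "poly_fun zy" "poly_fun wy"
    unfolding eqs by (intro poly_fun_add poly_fun_diff poly_fun_mult poly_fun_konst poly_fun_mono)+
qed

lemma poly_fun_zmono: "poly_fun (zmono a b c d)"
  unfolding zmono_def by (intro poly_fun_mult poly_fun_power poly_fun_coords)

lemma zmono_mult: "zmono a b c d * zmono a' b' c' d' = zmono (a+a') (b+b') (c+c') (d+d')"
  unfolding zmono_def by (simp only: power_add ac_simps)

lemma mono_eq_powers:
  "mono (a,b,c,d) = mono (1,0,0,0) ^ a * mono (0,1,0,0) ^ b * mono (0,0,1,0) ^ c * mono (0,0,0,1) ^ d"
  by (simp add: fun_eq_iff mono_def power_fun_apply)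

lemma zmono_in_span: "zmono a b c d \<in> fs.span zmonos"
  by (rule fs.span_base) (auto simp: zmonos_def)

lemma span_zmonos_mult:
  assumes "f \<in> fs.span zmonos" "g \<in> fs.span zmonos"
  shows "f * g \<in> fs.span zmonos"
proof (rule span_mult[OF assms fs.subspace_span])
  fix s t assume "s \<in> zmonos" "t \<in> zmonos"
  then show "s * t \<in> fs.span zmonos"
    unfolding zmonos_def by (elim CollectE exE) (simp only: zmono_mult zmono_in_span[unfolded zmonos_def])
qed

lemma span_zmonos_power: "f \<in> fs.span zmonos \<Longrightarrow> f ^ n \<in> fs.span zmonos"
proof (induction n)
  case 0
  have "1 = zmono 0 0 0 0" by (simp add: zmono_def)
  then show ?case by (metis power_0 zmono_in_span)
next
  case (Suc n)
  then show ?case by (simp only: power_Suc span_zmonos_mult)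
qed

text \<open>The change of coordinates is invertible: \<open>x1 = (zx + wx) / 2\<close> and
  \<open>x2 = (zx - wx) / (2 * \<i>)\<close>, and likewise for \<open>y\<close>.\<close>

lemma poly_fun_in_span_zmonos:
  assumes "poly_fun f" shows "f \<in> fs.span zmonos"
proof -
  have "mono (1,0,0,0) = konst (1/2) * zmono 1 0 0 0 + konst (1/2) * zmono 0 1 0 0"
    "mono (0,1,0,0) = konst (1/(2*\<i>)) * zmono 1 0 0 0 - konst (1/(2*\<i>)) * zmono 0 1 0 0"
    "mono (0,0,1,0) = konst (1/2) * zmono 0 0 1 0 + konst (1/2) * zmono 0 0 0 1"
    "mono (0,0,0,1) = konst (1/(2*\<i>)) * zmono 0 0 1 0 - konst (1/(2*\<i>)) * zmono 0 0 0 1"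
    by (auto simp: fun_eq_iff zmono_def mono_def zx_def wx_def zy_def wy_def field_simps)
  then have *: "mono (1,0,0,0) \<in> fs.span zmonos" "mono (0,1,0,0) \<in> fs.span zmonos"
    "mono (0,0,1,0) \<in> fs.span zmonos" "mono (0,0,0,1) \<in> fs.span zmonos"
    by (simp_all only: fs.span_add fs.span_diff fs.span_scale zmono_in_span)
  have "mono (a,b,c,d) \<in> fs.span zmonos" for a b c d
    by (subst mono_eq_powers) (intro span_zmonos_mult span_zmonos_power *)
  then have "range mono \<subseteq> fs.span zmonos" by auto
  then have "fs.span (range mono) \<subseteq> fs.span zmonos"
    by (rule fs.span_minimal) (rule fs.subspace_span)
  with assms show ?thesis by (auto simp: poly_fun_iff_span)
qed

definition Delta :: "pt \<Rightarrow> complex" where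
  "Delta = zx * wy - wx * zy"

definition galt :: "nat \<Rightarrow> nat \<Rightarrow> pt \<Rightarrow> complex" where
  "galt k i = zx ^ (k - i) * zy ^ i - wx ^ (k - i) * wy ^ i"

definition alt_gens :: "nat \<Rightarrow> (pt \<Rightarrow> complex) set" where
  "alt_gens k = insert Delta (galt k ` {..k})"

text \<open>Induction on the degree: a factor of degree \<open>k\<close> is split off, and
  \<open>P * Q - P' * Q' = Q * (P - P') + P' * (Q - Q')\<close> leaves one \<open>galt k i\<close>
  and a shorter difference.\<close>

lemma antisym_pure_in_ideal:
  assumes "k > 0" "poly_ideal I" "alt_gens k \<subseteq> I" "k dvd a + c"
  shows "zx ^ a * zy ^ c - wx ^ a * wy ^ c \<in> I"
  using assms(4)
proof (induction "a + c" arbitrary: a c rule: less_induct)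
  case less
  show ?case
  proof (cases "a + c = 0")
    case True
    then show ?thesis using poly_ideal_0[OF assms(2)] by simp
  next
    case False
    \<comment> \<open>The split-off factor takes as many \<open>zy\<close> as possible; the
      remaining \<open>k - i\<close> factors \<open>zx\<close> are available because
      \<open>k \<le> a + c\<close>.\<close>
    define i where "i = min c k"
    have i: "i \<le> k" "i \<le> c" "k - i \<le> a"
      using less.prems False by (auto simp: i_def dest: dvd_imp_le)
    obtain a' c' where ac: "a = (k - i) + a'" "c = i + c'"
      using i by (metis le_Suc_ex)
    from less.prems have "k dvd k + (a' + c')" using ac i(1) by (simp add: algebra_simps)
    then have "k dvd a' + c'" by (simp only: dvd_add_right_iff dvd_refl)
    moreover have "a' + c' < a + c" using ac i(1) \<open>k > 0\<close> by simp
    ultimately have IH: "zx ^ a' * zy ^ c' - wx ^ a' * wy ^ c' \<in> I"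
      using less.hyps by blast
    have g: "galt k i \<in> I" using assms(3) i(1) by (auto simp: alt_gens_def)
    have eq: "zx ^ a * zy ^ c - wx ^ a * wy ^ c = (zx ^ a' * zy ^ c') * galt k i
        + (wx ^ (k - i) * wy ^ i) * (zx ^ a' * zy ^ c' - wx ^ a' * wy ^ c')"
      unfolding ac galt_def power_add by (simp only: algebra_simps)
    show ?thesis unfolding eq
      by (intro poly_ideal_add[OF assms(2)] poly_ideal_mult[OF assms(2)] g IH
           poly_fun_mult poly_fun_power poly_fun_coords)
  qed
qed

lemma zmono_Suc:
  "zmono (Suc a) b c d = zx * zmono a b c d" "zmono a (Suc b) c d = wx * zmono a b c d"
  "zmono a b (Suc c) d = zy * zmono a b c d" "zmono a b c (Suc d) = wy * zmono a b c d"
  unfolding zmono_def by (simp_all only: power_Suc ac_simps)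

text \<open>Any factor \<open>z\<close> and any factor \<open>w\<close> can be split off together: \<open>zx wx\<close> and \<open>zy wy\<close> are invariant
  under the swap, and \<open>zx wy\<close>, \<open>wx zy\<close> agree modulo \<open>Delta\<close>.\<close>

lemma antisym_in_ideal:
  assumes k: "k > 0" and I: "poly_ideal I" and gens: "alt_gens k \<subseteq> I"
  shows "int k dvd (int a + int c) - (int b + int d) \<Longrightarrow> zmono a b c d - zmono b a d c \<in> I"
proof (induction "a + b + c + d" arbitrary: a b c d rule: less_induct)
  case less
  have D: "Delta \<in> I" using gens by (auto simp: alt_gens_def)
  \<comment> \<open>If no exponent of a \<open>z\<close> is positive together with an exponent of a
    \<open>w\<close>, the monomial is pure in \<open>z\<close> or pure in \<open>w\<close>, and the
    weight condition becomes divisibility of its degree by \<open>k\<close>.\<close>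
  consider "a > 0" "b > 0" | "c > 0" "d > 0" | "a > 0" "d > 0" | "b > 0" "c > 0"
    | "b = 0" "d = 0" | "a = 0" "c = 0" by blast
  then show ?case
  proof cases
    case 1
    then obtain a' b' where s: "a = Suc a'" "b = Suc b'" by (metis gr0_implies_Suc)
    have eq: "zmono a b c d - zmono b a d c = (zx * wx) * (zmono a' b' c d - zmono b' a' d c)"
      unfolding s zmono_Suc by (simp only: algebra_simps)
    have IH: "zmono a' b' c d - zmono b' a' d c \<in> I"
      using less.prems by (intro less.hyps) (auto simp: s algebra_simps)
    show ?thesis unfolding eq by (intro poly_ideal_mult[OF I] IH poly_fun_mult poly_fun_coords)
  next
    case 2
    then obtain c' d' where s: "c = Suc c'" "d = Suc d'" by (metis gr0_implies_Suc)
    have eq: "zmono a b c d - zmono b a d c = (zy * wy) * (zmono a b c' d' - zmono b a d' c')"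
      unfolding s zmono_Suc by (simp only: algebra_simps)
    have IH: "zmono a b c' d' - zmono b a d' c' \<in> I"
      using less.prems by (intro less.hyps) (auto simp: s algebra_simps)
    show ?thesis unfolding eq by (intro poly_ideal_mult[OF I] IH poly_fun_mult poly_fun_coords)
  next
    case 3
    then obtain a' d' where s: "a = Suc a'" "d = Suc d'" by (metis gr0_implies_Suc)
    have eq: "zmono a b c d - zmono b a d c
        = (wx * zy) * (zmono a' b c d' - zmono b a' d' c) + zmono a' b c d' * Delta"
      unfolding s zmono_Suc Delta_def by (simp only: algebra_simps)
    have IH: "zmono a' b c d' - zmono b a' d' c \<in> I"
      using less.prems by (intro less.hyps) (auto simp: s algebra_simps)
    show ?thesis unfolding eq
      by (intro poly_ideal_add[OF I] poly_ideal_mult[OF I] IH D poly_fun_mult poly_fun_coords poly_fun_zmono)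
  next
    case 4
    then obtain b' c' where s: "b = Suc b'" "c = Suc c'" by (metis gr0_implies_Suc)
    have eq: "zmono a b c d - zmono b a d c
        = (wx * zy) * (zmono a b' c' d - zmono b' a d c') - zmono b' a d c' * Delta"
      unfolding s zmono_Suc Delta_def by (simp only: algebra_simps)
    have IH: "zmono a b' c' d - zmono b' a d c' \<in> I"
      using less.prems by (intro less.hyps) (auto simp: s algebra_simps)
    show ?thesis unfolding eq
      by (intro poly_ideal_diff[OF I] poly_ideal_mult[OF I] IH D poly_fun_mult poly_fun_coords poly_fun_zmono)
  next
    case 5
    with less.prems have "int k dvd int (a + c)" by simp
    then have "k dvd a + c" by (simp only: int_dvd_int_iff)
    from antisym_pure_in_ideal[OF k I gens this] show ?thesis
      using 5 by (simp only: zmono_def power_0 mult_1_left mult_1_right)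
  next
    case 6
    with less.prems have "int k dvd - int (b + d)" by (simp add: algebra_simps)
    then have "k dvd b + d" by (simp only: int_dvd_int_iff dvd_minus_iff)
    from poly_ideal_uminus[OF I antisym_pure_in_ideal[OF k I gens this]] show ?thesis
      using 6 by (simp only: zmono_def power_0 mult_1_left mult_1_right minus_diff_eq)
  qed
qed

section \<open>Roots of unity and the group action in the diagonalizing coordinates\<close>

definition unit_root :: "nat \<Rightarrow> int \<Rightarrow> complex" where
  "unit_root k N = cis (2 * pi * of_int N / real k)"

lemma unit_root_add: "unit_root k (M + N) = unit_root k M * unit_root k N"
  by (simp add: unit_root_def cis_mult add_divide_distrib distrib_left)

lemma unit_root_power: "unit_root k N ^ n = unit_root k (int n * N)"
  by (simp add: unit_root_def DeMoivre mult.left_commute mult.assoc)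

lemma unit_root_eq_1_iff:
  assumes "k > 0" shows "unit_root k N = 1 \<longleftrightarrow> int k dvd N"
proof
  assume "unit_root k N = 1"
  \<comment> \<open>The real part suffices: cosine 1 already forces the angle to be a multiple of
    \<open>2 * pi\<close>.\<close>
  then have "cos (2 * pi * of_int N / real k) = 1"
    by (metis unit_root_def one_complex.sel(1) cis.sel(1))
  then obtain n :: int where "2 * pi * of_int N / real k = of_int n * 2 * pi"
    using cos_one_2pi_int by blast
  then have "real_of_int N = real_of_int (n * int k)" using assms by (simp add: field_simps)
  then show "int k dvd N" by (metis of_int_eq_iff dvd_triv_right)
next
  assume "int k dvd N"
  then obtain n where "N = int k * n" by (elim dvdE)
  then have "2 * pi * of_int N / real k = 2 * pi * of_int n" using assms by simp
  then show "unit_root k N = 1" unfolding unit_root_def by (simp only: cis_multiple_2pi Ints_of_int)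
qed

text \<open>Orthogonality of characters of the cyclic group: a geometric sum whose ratio has
  \<open>k\<close>-th power 1.\<close>

lemma sum_unit_root:
  assumes "k > 0"
  shows "(\<Sum>j<k. unit_root k (int j * N)) = (if int k dvd N then of_nat k else 0)"
proof -
  have eq: "(\<Sum>j<k. unit_root k (int j * N)) = (\<Sum>j<k. unit_root k N ^ j)"
    by (simp add: unit_root_power)
  show ?thesis
  proof (cases "int k dvd N")
    case True
    then have "unit_root k N = 1" using unit_root_eq_1_iff[OF assms] by simp
    with eq True show ?thesis by simp
  next
    case False
    then have "unit_root k N \<noteq> 1" using unit_root_eq_1_iff[OF assms] by simp
    moreover have "unit_root k N ^ k = 1"
      by (simp add: unit_root_power unit_root_eq_1_iff[OF assms])
    ultimately show ?thesis using eq False by (simp add: geometric_sum)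
  qed
qed

lemma det2_rot: "det2 (rot k j) = 1" and det2_refl: "det2 (refl k j) = -1"
proof -
  define t where "t = 2 * pi * real j / real k"
  have "cos t * cos t + sin t * sin t = 1" by (rule sin_cos_squared_add3)
  moreover have "det2 (rot k j) = cos t * cos t + sin t * sin t"
    "det2 (refl k j) = - (cos t * cos t) - sin t * sin t"
    by (simp_all add: det2_def rot_def refl_def Let_def t_def)
  ultimately show "det2 (rot k j) = 1" "det2 (refl k j) = -1" by linarith+
qed

lemma act_mult: "act w (f * g) = act w f * act w g"
  and act_add: "act w (f + g) = act w f + act w g"
  and act_diff: "act w (f - g) = act w f - act w g"
  and act_konst: "act w (konst c) = konst c"
  and act_1: "act w 1 = 1"
  by (auto simp: act_def fun_eq_iff)

lemma act_power: "act w (f ^ n) = act w f ^ n"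
  by (induction n) (simp_all only: power_0 power_Suc act_1 act_mult)

lemma cis_expand: "cis t = of_real (cos t) + \<i> * of_real (sin t)"
  by (simp add: complex_eq_iff)

text \<open>\<open>act\<close> substitutes the inverse matrix, so \<open>zx\<close> and
  \<open>zy\<close> receive the root with exponent \<open>- int j\<close>.\<close>

lemma act_rot_coords:
  "act (rot k j) zx = konst (unit_root k (- int j)) * zx"
  "act (rot k j) wx = konst (unit_root k (int j)) * wx"
  "act (rot k j) zy = konst (unit_root k (- int j)) * zy"
  "act (rot k j) wy = konst (unit_root k (int j)) * wy"
  using det2_rot[of k j]
  by (auto simp: fun_eq_iff act_def zx_def wx_def zy_def wy_def unit_root_def cis_expand
      inv2_def rot_def Let_def lin2_def algebra_simps)

text \<open>A reflection is its own inverse, and \<open>refl k j\<close> carries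
  \<open>x1 + \<i> * x2\<close> to a root of unity times \<open>x1 - \<i> * x2\<close>.\<close>

lemma act_refl_coords:
  "act (refl k j) zx = konst (unit_root k (int j)) * wx"
  "act (refl k j) wx = konst (unit_root k (- int j)) * zx"
  "act (refl k j) zy = konst (unit_root k (int j)) * wy"
  "act (refl k j) wy = konst (unit_root k (- int j)) * zy"
  using det2_refl[of k j]
  by (auto simp: fun_eq_iff act_def zx_def wx_def zy_def wy_def unit_root_def cis_expand
      inv2_def refl_def Let_def lin2_def algebra_simps)

lemma konst_mult: "konst c * konst d = konst (c * d)"
  and konst_power: "konst c ^ n = konst (c ^ n)"
  by (simp_all add: fun_eq_iff power_fun_apply)

lemma act_rot_zmono:
  "act (rot k j) (zmono a b c d) =
     konst (unit_root k (int j * ((int b + int d) - (int a + int c)))) * zmono a b c d"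
proof -
  have "unit_root k (int j * ((int b + int d) - (int a + int c))) = unit_root k (- int j) ^ a
      * unit_root k (int j) ^ b * unit_root k (- int j) ^ c * unit_root k (int j) ^ d"
    by (simp add: unit_root_power flip: unit_root_add) (simp add: algebra_simps)
  then show ?thesis
    by (simp only: zmono_def act_mult act_power act_rot_coords power_mult_distrib konst_power
        flip: konst_mult) (simp only: ac_simps)
qed

lemma act_refl_zmono:
  "act (refl k j) (zmono a b c d) =
     konst (unit_root k (int j * ((int a + int c) - (int b + int d)))) * zmono b a d c"
proof -
  have "unit_root k (int j * ((int a + int c) - (int b + int d))) = unit_root k (int j) ^ a
      * unit_root k (- int j) ^ b * unit_root k (int j) ^ c * unit_root k (- int j) ^ d"
    by (simp add: unit_root_power flip: unit_root_add) (simp add: algebra_simps)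
  then show ?thesis
    by (simp only: zmono_def act_mult act_power act_refl_coords power_mult_distrib konst_power
        flip: konst_mult) (simp only: ac_simps)
qed

text \<open>Divisibility of the weight by \<open>k\<close> makes all roots of unity trivial:
  rotations fix both monomials and reflections exchange them.\<close>

lemma alternant_antisym:
  assumes "k > 0" "int k dvd (int a + int c) - (int b + int d)"
  shows "alternant (dihedral k) (zmono a b c d - zmono b a d c)"
proof -
  have N: "int k dvd (int b + int d) - (int a + int c)"
    using assms(2) by (simp add: dvd_diff_commute)
  have u: "unit_root k (int j * ((int a + int c) - (int b + int d))) = 1"
    "unit_root k (int j * ((int b + int d) - (int a + int c))) = 1" for j
    using assms(2) N by (simp_all only: unit_root_eq_1_iff[OF assms(1)] dvd_mult)
  have "konst 1 = 1" by (simp add: fun_eq_iff)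
  then have
    "act (rot k j) (zmono a b c d - zmono b a d c) = zmono a b c d - zmono b a d c"
    "act (refl k j) (zmono a b c d - zmono b a d c) = - (zmono a b c d - zmono b a d c)" for j
    by (simp_all only: act_diff act_rot_zmono act_refl_zmono u mult_1_left minus_diff_eq)
  then show ?thesis
    by (auto simp: alternant_def dihedral_def det2_rot det2_refl fun_eq_iff
        intro!: poly_fun_diff poly_fun_zmono)
qed

text \<open>The sum of \<open>det(w)\<close> times the action of \<open>w\<close> over the group,
  without division by the group order \<open>2 * k\<close>.\<close>

definition antisymmetrize :: "nat \<Rightarrow> (pt \<Rightarrow> complex) \<Rightarrow> pt \<Rightarrow> complex" where
  "antisymmetrize k f = (\<Sum>j<k. act (rot k j) f) - (\<Sum>j<k. act (refl k j) f)"

lemma antisymmetrize_add: "antisymmetrize k (f + g) = antisymmetrize k f + antisymmetrize k g"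
  unfolding antisymmetrize_def by (simp only: act_add sum.distrib algebra_simps)

lemma antisymmetrize_scale: "antisymmetrize k (konst c * f) = konst c * antisymmetrize k f"
  unfolding antisymmetrize_def
  by (simp only: act_mult act_konst right_diff_distrib flip: sum_distrib_left)

lemma sum_konst_mult: "(\<Sum>j\<in>A. konst (c j) * f) = konst (\<Sum>j\<in>A. c j) * f"
  by (simp add: fun_eq_iff sum_fun_apply sum_distrib_right)

text \<open>Summing the roots of unity over \<open>j\<close> kills every monomial whose weight is
  not divisible by \<open>k\<close>.\<close>

lemma antisymmetrize_zmono:
  assumes "k > 0"
  shows "antisymmetrize k (zmono a b c d) =
    konst (if int k dvd (int a + int c) - (int b + int d) then of_nat k else 0) * (zmono a b c d - zmono b a d c)"
  unfolding antisymmetrize_def act_rot_zmono act_refl_zmono sum_konst_mult sum_unit_root[OF assms]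
  by (simp only: dvd_diff_commute[of _ "int b + int d"] right_diff_distrib)

lemma antisymmetrize_alternant:
  assumes "alternant (dihedral k) p"
  shows "antisymmetrize k p = konst (2 * of_nat k) * p"
proof -
  have "act (rot k j) p = p" "act (refl k j) p = - p" if "j < k" for j
  proof -
    have "rot k j \<in> dihedral k" "refl k j \<in> dihedral k" using that by (auto simp: dihedral_def)
    with assms show "act (rot k j) p = p" "act (refl k j) p = - p"
      by (auto simp: alternant_def det2_rot det2_refl fun_eq_iff)
  qed
  then show ?thesis
    by (simp add: antisymmetrize_def sum_negf) (simp add: fun_eq_iff)
qed

lemma subspace_poly_ideal: "poly_ideal I \<Longrightarrow> fs.subspace I"
  by (rule fs.subspaceI) (auto intro: poly_idealD poly_ideal_mult poly_fun_konst)

text \<open>By linearity only the monomials in the \<open>z\<close> and \<open>w\<close> coordinates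
  matter; their images are zero or \<open>k\<close> times a difference covered by
  \<open>antisym_in_ideal\<close>.\<close>

lemma antisymmetrize_in_ideal:
  assumes k: "k > 0" and I: "poly_ideal I" and gens: "alt_gens k \<subseteq> I" and p: "poly_fun p"
  shows "antisymmetrize k p \<in> I"
  using poly_fun_in_span_zmonos[OF p]
proof (induction rule: fs.span_induct_alt)
  case base
  show ?case using poly_ideal_0[OF I] antisymmetrize_scale[of k 0 0]
    by (simp only: mult_zero_left mult_zero_right) (simp add: antisymmetrize_def act_def fun_eq_iff zero_fun_def)
next
  case (step r x y)
  then obtain a b c d where x: "x = zmono a b c d" by (auto simp: zmonos_def)
  have "antisymmetrize k (zmono a b c d) \<in> I"
  proof (cases "int k dvd (int a + int c) - (int b + int d)")
    case True
    from poly_ideal_mult[OF I poly_fun_konst antisym_in_ideal[OF k I gens this], of "of_nat k"] True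
    show ?thesis by (simp only: antisymmetrize_zmono[OF k] if_True)
  next
    case False
    from poly_ideal_0[OF I] False show ?thesis
      by (simp add: antisymmetrize_zmono[OF k])
  qed
  then show ?case unfolding antisymmetrize_add antisymmetrize_scale x
    using step.IH I poly_ideal_add poly_ideal_mult poly_fun_konst by blast
qed

text \<open>An alternant is its antisymmetrization divided by \<open>2 * k\<close>, hence lies in
  the ideal on the right; conversely, each generator there is a difference of swapped monomials of
  weight divisible by \<open>k\<close>, hence an alternant.\<close>

lemma alt_ideal_dihedral:
  assumes k: "k > 0"
  shows "alt_ideal (dihedral k) = gen_ideal (alt_gens k)"
proof
  show "alt_ideal (dihedral k) \<subseteq> gen_ideal (alt_gens k)"
    unfolding alt_ideal_def
  proof (rule gen_ideal_least[OF poly_ideal_gen_ideal], rule subsetI)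
    fix p assume "p \<in> {p. alternant (dihedral k) p}"
    then have p: "alternant (dihedral k) p" "poly_fun p" by (auto simp: alternant_def)
    have "antisymmetrize k p \<in> gen_ideal (alt_gens k)"
      using gen_ideal_base by (intro antisymmetrize_in_ideal k poly_ideal_gen_ideal p) auto
    then have "konst (1 / (2 * of_nat k)) * antisymmetrize k p \<in> gen_ideal (alt_gens k)"
      by (intro poly_ideal_mult[OF poly_ideal_gen_ideal] poly_fun_konst)
    also have "konst (1 / (2 * of_nat k)) * antisymmetrize k p = p"
      unfolding antisymmetrize_alternant[OF p(1)] using k by (simp add: fun_eq_iff)
    finally show "p \<in> gen_ideal (alt_gens k)" .
  qed
next
  have D: "Delta = zmono 1 0 0 1 - zmono 0 1 1 0" by (simp add: Delta_def zmono_def)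
  have "alternant (dihedral k) Delta" unfolding D using k by (rule alternant_antisym) simp
  moreover have "alternant (dihedral k) (galt k i)" if "i \<le> k" for i
  proof -
    have g: "galt k i = zmono (k - i) 0 i 0 - zmono 0 (k - i) 0 i" by (simp add: galt_def zmono_def)
    show ?thesis unfolding g using k by (rule alternant_antisym) (use that in \<open>simp add: of_nat_diff\<close>)
  qed
  ultimately have "alt_gens k \<subseteq> alt_ideal (dihedral k)"
    unfolding alt_ideal_def by (auto simp: alt_gens_def intro!: gen_ideal_base)
  then show "gen_ideal (alt_gens k) \<subseteq> alt_ideal (dihedral k)"
    by (rule gen_ideal_least[rotated]) (simp add: alt_ideal_def poly_ideal_gen_ideal)
qed

section \<open>Powers of the alternating ideal\<close>

text \<open>\<open>Gpow k j s\<close> is one product of \<open>j\<close> elements \<open>galt k i\<close> with index sum \<open>s\<close>, the indices being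
  chosen greedily. The index sum is correct only for \<open>s \<le> j * k\<close>.\<close>

fun Gpow :: "nat \<Rightarrow> nat \<Rightarrow> nat \<Rightarrow> pt \<Rightarrow> complex" where
  "Gpow k 0 s = 1"
| "Gpow k (Suc j) s = galt k (min s k) * Gpow k j (s - min s k)"

definition pow_gens :: "nat \<Rightarrow> nat \<Rightarrow> (pt \<Rightarrow> complex) set" where
  "pow_gens k m = {Delta ^ (m - j) * Gpow k j s | j s. j \<le> m \<and> s \<le> j * k}"

lemma pow_gensI: "j \<le> m \<Longrightarrow> s \<le> j * k \<Longrightarrow> Delta ^ (m - j) * Gpow k j s \<in> pow_gens k m"
  unfolding pow_gens_def by blast

lemma poly_fun_Delta: "poly_fun Delta"
  unfolding Delta_def by (intro poly_fun_diff poly_fun_mult poly_fun_coords)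

lemma poly_fun_galt: "poly_fun (galt k i)"
  unfolding galt_def by (intro poly_fun_diff poly_fun_mult poly_fun_power poly_fun_coords)

lemma poly_fun_Gpow: "poly_fun (Gpow k j s)"
  by (induction j arbitrary: s) (auto intro: poly_fun_1 poly_fun_mult poly_fun_galt)

lemma Delta_in_ideal: "Delta \<in> gen_ideal (alt_gens k)"
  and galt_in_ideal: "i \<le> k \<Longrightarrow> galt k i \<in> gen_ideal (alt_gens k)"
  by (auto simp: alt_gens_def intro!: gen_ideal_base)

lemma alt_gens_subset: "alt_gens k \<subseteq> gen_ideal (alt_gens k)"
  using gen_ideal_base by blast

text \<open>Moving \<open>r\<close> units of index between two factors changes their product by a
  multiple of \<open>(wx * zy) ^ r - (zx * wy) ^ r\<close>, which is divisible by
  \<open>Delta\<close>; the cofactor is antisymmetric and therefore again in the ideal.\<close>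

lemma galt_exchange_shift:
  assumes k: "k > 0" and le: "i + r \<le> k" "l + r \<le> k"
  shows "\<exists>h\<in>gen_ideal (alt_gens k). galt k i * galt k (l + r) - galt k (i + r) * galt k l = Delta * h"
proof -
  obtain u v where u: "k = i + r + u" and v: "k = l + r + v"
    using le by (metis le_Suc_ex)
  \<comment> \<open>The pure terms of both products cancel and the mixed terms leave this
    difference; its weight is zero since \<open>u + i\<close> and \<open>v + l\<close> both equal
    \<open>k - r\<close>.\<close>
  define M where "M = zmono u v i l - zmono v u l i"
  \<comment> \<open>The cofactor of \<open>Delta\<close> in the difference of \<open>r\<close>-th
    powers, up to sign.\<close>
  define S where "S = (\<Sum>p<r. (wx * zy) ^ (r - Suc p) * (zx * wy) ^ p)"
  have "M \<in> gen_ideal (alt_gens k)"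
    unfolding M_def
  proof (intro antisym_in_ideal[OF k poly_ideal_gen_ideal alt_gens_subset])
    have "(int u + int i) - (int v + int l) = 0" using u v by simp
    then show "int k dvd (int u + int i) - (int v + int l)" by (simp only: dvd_0_right)
  qed
  moreover have "poly_fun S"
    unfolding S_def by (intro poly_fun_sum poly_fun_mult poly_fun_power poly_fun_coords)
  ultimately have "- (S * M) \<in> gen_ideal (alt_gens k)"
    by (intro poly_ideal_uminus poly_ideal_mult poly_ideal_gen_ideal)
  moreover have "galt k i * galt k (l + r) - galt k (i + r) * galt k l = Delta * - (S * M)"
  proof -
    have e: "k - i = u + r" "k - (l + r) = v" "k - (i + r) = u" "k - l = v + r"
      using u v by auto
    have "galt k i * galt k (l + r) - galt k (i + r) * galt k l
        = ((wx * zy) ^ r - (zx * wy) ^ r) * M"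
      unfolding galt_def e M_def zmono_def power_add power_mult_distrib by (simp only: algebra_simps)
    also have "(wx * zy) ^ r - (zx * wy) ^ r = - (Delta * S)"
      unfolding Delta_def S_def by (simp only: minus_diff_eq flip: power_diff_sumr2)
    finally show ?thesis by (simp only: mult.assoc mult_minus_right mult_minus_left)
  qed
  ultimately show ?thesis by blast
qed

text \<open>Two index pairs with equal sum differ by a shift; if it goes in the opposite direction,
  the pairs trade roles and the sign changes.\<close>

lemma galt_exchange:
  assumes k: "k > 0" and le: "i \<le> k" "l \<le> k" "i' \<le> k" "l' \<le> k" and sum: "i + l = i' + l'"
  shows "\<exists>h\<in>gen_ideal (alt_gens k). galt k i * galt k l - galt k i' * galt k l' = Delta * h"
proof (cases "i \<le> i'")
  case True
  then obtain r where "i' = i + r" "l = l' + r" using sum by (metis le_Suc_ex add.assoc add.commute add_left_cancel)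
  with galt_exchange_shift[OF k, of i r l'] le show ?thesis by simp
next
  case False
  then obtain r where r: "i = i' + r" "l' = l + r"
    using sum by (metis le_Suc_ex add.assoc add.commute add_left_cancel nat_le_linear)
  with galt_exchange_shift[OF k, of i' r l] le
  obtain h where h: "h \<in> gen_ideal (alt_gens k)" "galt k i' * galt k l' - galt k i * galt k l = Delta * h"
    by auto
  have "galt k i * galt k l - galt k i' * galt k l' = - (galt k i' * galt k l' - galt k i * galt k l)"
    by (simp only: minus_diff_eq)
  also have "\<dots> = Delta * - h" by (simp only: h mult_minus_right)
  finally show ?thesis using poly_ideal_uminus[OF poly_ideal_gen_ideal h(1)] by blast
qed

lemma Gpow_in_ideal_pow: "Gpow k j s \<in> ideal_pow (gen_ideal (alt_gens k)) j"
  by (induction j arbitrary: s) (auto intro!: poly_fun_1 ideal_prod_mult galt_in_ideal)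

text \<open>A new factor is inserted into the greedy product. Exchanging it with the first factor
  makes the first index greedy again, and the leftover index is inserted into the shorter product.
  In each error term one \<open>Delta\<close> replaces one of the \<open>j + 1\<close>
  factors.\<close>

lemma galt_mult_Gpow:
  assumes k: "k > 0"
  shows "i \<le> k \<Longrightarrow> s \<le> j * k \<Longrightarrow>
    \<exists>h\<in>ideal_pow (gen_ideal (alt_gens k)) j. galt k i * Gpow k j s - Gpow k (Suc j) (s + i) = Delta * h"
proof (induction j arbitrary: i s)
  case 0
  then have "galt k i * Gpow k 0 s - Gpow k (Suc 0) (s + i) = Delta * 0" by simp
  then show ?case using poly_ideal_0[OF poly_ideal_ideal_pow] by blast
next
  case (Suc j)
  define l where "l = min s k"
  \<comment> \<open>The first index that the greedy choice prescribes for the new sum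
    \<open>s + i\<close>; the exchange turns the pair \<open>(i, l)\<close> into
    \<open>(l', i')\<close>.\<close>
  define l' where "l' = min (s + i) k"
  define i' where "i' = i + l - l'"
  define s' where "s' = s - l"
  have bounds: "l \<le> k" "l' \<le> k" "i' \<le> k" "i + l = l' + i'" "s' \<le> j * k" "s + i - l' = s' + i'"
    using Suc.prems by (auto simp: l_def l'_def i'_def s'_def min_def)
  obtain h0 where h0: "h0 \<in> gen_ideal (alt_gens k)" "galt k i * galt k l - galt k l' * galt k i' = Delta * h0"
    using galt_exchange[OF k Suc.prems(1) bounds(1,2,3,4)] by blast
  obtain h1 where h1: "h1 \<in> ideal_pow (gen_ideal (alt_gens k)) j"
      "galt k i' * Gpow k j s' - Gpow k (Suc j) (s' + i') = Delta * h1"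
    using Suc.IH[OF bounds(3,5)] by blast
  have "galt k i * Gpow k (Suc j) s - Gpow k (Suc (Suc j)) (s + i)
      = galt k i * (galt k l * Gpow k j s') - galt k l' * Gpow k (Suc j) (s' + i')"
    using bounds(6) by (simp only: Gpow.simps l_def[symmetric] l'_def[symmetric] s'_def[symmetric])
  also have "\<dots> = (galt k i * galt k l - galt k l' * galt k i') * Gpow k j s'
      + galt k l' * (galt k i' * Gpow k j s' - Gpow k (Suc j) (s' + i'))"
    by (simp only: algebra_simps)
  also have "\<dots> = Delta * (h0 * Gpow k j s' + galt k l' * h1)"
    unfolding h0 h1 by (simp only: algebra_simps)
  finally have "galt k i * Gpow k (Suc j) s - Gpow k (Suc (Suc j)) (s + i)
      = Delta * (h0 * Gpow k j s' + galt k l' * h1)" .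
  moreover have "h0 * Gpow k j s' + galt k l' * h1 \<in> ideal_pow (gen_ideal (alt_gens k)) (Suc j)"
    unfolding ideal_pow.simps using h0(1) h1(1) bounds(2)
    by (intro poly_ideal_add[OF poly_ideal_ideal_prod] ideal_prod_mult galt_in_ideal Gpow_in_ideal_pow)
  ultimately show ?case by (rule bexI)
qed

lemma Delta_power_mult_in_ideal_pow:
  "f \<in> ideal_pow (gen_ideal (alt_gens k)) j \<Longrightarrow> Delta ^ n * f \<in> ideal_pow (gen_ideal (alt_gens k)) (n + j)"
  by (induction n) (auto simp: mult.assoc intro!: ideal_prod_mult Delta_in_ideal)

lemma Delta_mult_pow_gens: "f \<in> gen_ideal (pow_gens k m) \<Longrightarrow> Delta * f \<in> gen_ideal (pow_gens k (Suc m))"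
proof -
  assume f: "f \<in> gen_ideal (pow_gens k m)"
  have "pow_gens k m \<subseteq> {f. f * Delta \<in> gen_ideal (pow_gens k (Suc m))}"
  proof
    fix g assume "g \<in> pow_gens k m"
    then obtain j s where g: "g = Delta ^ (m - j) * Gpow k j s" and js: "j \<le> m" "s \<le> j * k"
      by (auto simp: pow_gens_def)
    have "g * Delta = Delta ^ (Suc m - j) * Gpow k j s"
      unfolding g Suc_diff_le[OF js(1)] power_Suc by (simp only: ac_simps)
    also have "\<dots> \<in> gen_ideal (pow_gens k (Suc m))"
      using js by (intro gen_ideal_base pow_gensI) auto
    finally show "g \<in> {f. f * Delta \<in> gen_ideal (pow_gens k (Suc m))}" by blast
  qed
  from subsetD[OF gen_ideal_least[OF poly_ideal_vimage_mult[OF poly_ideal_gen_ideal] this] f]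
  show ?thesis by (simp add: mult.commute)
qed

text \<open>Multiplying a generator by \<open>Delta\<close> gives a generator of the next power;
  multiplying by \<open>galt k i\<close> does so up to \<open>Delta\<close> times an element of the
  current power, which the induction hypothesis rewrites in terms of generators.\<close>

lemma ideal_pow_alt_gens:
  assumes k: "k > 0"
  shows "ideal_pow (gen_ideal (alt_gens k)) m = gen_ideal (pow_gens k m)"
proof
  show "gen_ideal (pow_gens k m) \<subseteq> ideal_pow (gen_ideal (alt_gens k)) m"
  proof (rule gen_ideal_least[OF poly_ideal_ideal_pow], rule subsetI)
    fix g assume "g \<in> pow_gens k m"
    then obtain j s where "g = Delta ^ (m - j) * Gpow k j s" "j \<le> m"
      by (auto simp: pow_gens_def)
    then show "g \<in> ideal_pow (gen_ideal (alt_gens k)) m"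
      using Delta_power_mult_in_ideal_pow[OF Gpow_in_ideal_pow, of "m - j" k j s] by simp
  qed
  show "ideal_pow (gen_ideal (alt_gens k)) m \<subseteq> gen_ideal (pow_gens k m)"
  proof (induction m)
    case 0
    show ?case
    proof
      fix f assume "f \<in> ideal_pow (gen_ideal (alt_gens k)) 0"
      then have "poly_fun f" by simp
      moreover have "1 \<in> gen_ideal (pow_gens k 0)"
        by (rule gen_ideal_base) (auto simp: pow_gens_def)
      ultimately show "f \<in> gen_ideal (pow_gens k 0)"
        using poly_ideal_mult[OF poly_ideal_gen_ideal] by (metis mult_1_right)
    qed
  next
    case (Suc m)
    have "ideal_prod (gen_ideal (alt_gens k)) (gen_ideal (pow_gens k m)) \<subseteq> gen_ideal (pow_gens k (Suc m))"
    proof (rule ideal_prod_gen_ideal_least[OF poly_ideal_gen_ideal])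
      fix f g assume f: "f \<in> alt_gens k" and gm: "g \<in> pow_gens k m"
      then obtain j s where g: "g = Delta ^ (m - j) * Gpow k j s" and js: "j \<le> m" "s \<le> j * k"
        by (auto simp: pow_gens_def)
      consider "f = Delta" | i where "i \<le> k" "f = galt k i"
        using f by (auto simp: alt_gens_def)
      then show "f * g \<in> gen_ideal (pow_gens k (Suc m))"
      proof cases
        case 1
        with gm show ?thesis by (auto intro: Delta_mult_pow_gens gen_ideal_base)
      next
        case 2
        obtain h where h: "h \<in> ideal_pow (gen_ideal (alt_gens k)) j"
          "galt k i * Gpow k j s - Gpow k (Suc j) (s + i) = Delta * h"
          using galt_mult_Gpow[OF k 2(1) js(2)] by blast
        \<comment> \<open>The error \<open>h\<close> lies only in the \<open>j\<close>-th power; the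
          \<open>m - j\<close> factors \<open>Delta\<close> lift it to the \<open>m\<close>-th,
          where the induction hypothesis applies.\<close>
        have "Delta ^ (m - j) * h \<in> gen_ideal (pow_gens k m)"
          using Delta_power_mult_in_ideal_pow[OF h(1), of "m - j"] js(1) Suc.IH by auto
        then have "Delta * (Delta ^ (m - j) * h) \<in> gen_ideal (pow_gens k (Suc m))"
          by (rule Delta_mult_pow_gens)
        moreover have "Delta ^ (Suc m - Suc j) * Gpow k (Suc j) (s + i) \<in> gen_ideal (pow_gens k (Suc m))"
          using js 2(1) by (intro gen_ideal_base pow_gensI) auto
        moreover have "f * g = Delta ^ (Suc m - Suc j) * Gpow k (Suc j) (s + i) + Delta * (Delta ^ (m - j) * h)"
        proof -
          have "f * g = Delta ^ (m - j) * (galt k i * Gpow k j s)"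
            unfolding 2 g by (simp only: ac_simps)
          also have "galt k i * Gpow k j s = Gpow k (Suc j) (s + i) + Delta * h"
            using h(2) by (simp only: diff_eq_eq add.commute)
          finally show ?thesis by (simp only: distrib_left diff_Suc_Suc mult.left_commute)
        qed
        ultimately show ?thesis using poly_ideal_add[OF poly_ideal_gen_ideal] by (simp only:)
      qed
    qed
    moreover have "ideal_pow (gen_ideal (alt_gens k)) (Suc m)
        \<subseteq> ideal_prod (gen_ideal (alt_gens k)) (gen_ideal (pow_gens k m))"
      unfolding ideal_pow.simps
    proof (rule ideal_prod_least[OF poly_ideal_ideal_prod])
      fix f g assume "f \<in> gen_ideal (alt_gens k)" "g \<in> ideal_pow (gen_ideal (alt_gens k)) m"
      then show "f * g \<in> ideal_prod (gen_ideal (alt_gens k)) (gen_ideal (pow_gens k m))"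
        by (intro ideal_prod_mult subsetD[OF Suc.IH])
    qed
    ultimately show ?case by blast
  qed
qed

section \<open>Dimensions of quotients and bihomogeneous components\<close>

lemma sum_konst_delta:
  assumes "finite J" "j \<in> J"
  shows "(\<Sum>i\<in>J. konst (if i = j then c else 0) * f i) = konst c * f j"
proof -
  have "(\<Sum>i\<in>J. konst (if i = j then c else 0) * f i) = (\<Sum>i\<in>J. if i = j then konst c * f i else 0)"
    by (intro sum.cong refl) (simp add: fun_eq_iff)
  with assms show ?thesis by simp
qed

text \<open>Independence is stated for families, with coefficients on the index set, so that
  injectivity is a consequence and the library bound for independent sets applies to the
  image.\<close>

lemma independent_family_card_le:
  fixes s :: "'j \<Rightarrow> pt \<Rightarrow> complex"
  assumes J: "finite J"
    and ind: "\<And>c j. (\<Sum>j\<in>J. konst (c j) * s j) = 0 \<Longrightarrow> j \<in> J \<Longrightarrow> c j = 0"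
  shows "inj_on s J" "finite T \<Longrightarrow> s ` J \<subseteq> fs.span T \<Longrightarrow> card J \<le> card T"
proof -
  show inj: "inj_on s J"
  proof (rule inj_onI, rule ccontr)
    fix i j assume ij: "i \<in> J" "j \<in> J" "s i = s j" "i \<noteq> j"
    let ?c = "\<lambda>x. (if x = i then 1 else 0) - (if x = j then 1 else 0) :: complex"
    have "(\<Sum>x\<in>J. konst (?c x) * s x)
        = (\<Sum>x\<in>J. konst (if x = i then 1 else 0) * s x) - (\<Sum>x\<in>J. konst (if x = j then 1 else 0) * s x)"
      unfolding sum_subtractf[symmetric] by (intro sum.cong refl) (simp add: fun_eq_iff algebra_simps)
    also have "\<dots> = 0" using ij J by (simp add: sum_konst_delta)
    finally have "?c i = 0" using ind[of ?c i] ij by blast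
    with ij show False by simp
  qed
  assume T: "finite T" "s ` J \<subseteq> fs.span T"
  have "fs.independent (s ` J)"
  proof (rule fs.independent_if_scalars_zero)
    show "finite (s ` J)" using J by simp
    fix f x assume 0: "(\<Sum>x\<in>s ` J. konst (f x) * x) = 0" and x: "x \<in> s ` J"
    from 0 have "(\<Sum>j\<in>J. konst (f (s j)) * s j) = 0"
      by (subst (asm) sum.reindex[OF inj]) (simp add: o_def)
    with ind[of "\<lambda>j. f (s j)"] x show "f x = 0" by blast
  qed
  with fs.independent_span_bound[OF T(1) this T(2)] card_image[OF inj]
  show "card J \<le> card T" by simp
qed

text \<open>The family \<open>b\<close> represents a basis of \<open>V/U\<close>. For minimality,
  each \<open>b j\<close> is split along a competing set \<open>S\<close>; the parts in the span of
  \<open>S\<close> stay independent, as a relation among them would put a combination of the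
  \<open>b j\<close> into \<open>U\<close>.\<close>

lemma qdim_eq_card:
  fixes b :: "'j \<Rightarrow> pt \<Rightarrow> complex"
  assumes U: "fs.subspace U" and J: "finite J" and bV: "b ` J \<subseteq> V"
    and spanning: "\<And>f. f \<in> V \<Longrightarrow> \<exists>s\<in>fs.span (b ` J). \<exists>u\<in>U. f = s + u"
    and ind: "\<And>c j. (\<Sum>j\<in>J. konst (c j) * b j) \<in> U \<Longrightarrow> j \<in> J \<Longrightarrow> c j = 0"
  shows "qdim V U = card J"
proof -
  have set_eq: "{(\<lambda>z. s z + u z) | s u. s \<in> cspan S \<and> u \<in> U} = {s + u | s u. s \<in> fs.span S \<and> u \<in> U}" for S
    by (simp add: cspan_eq_span plus_fun_def)
  have injb: "inj_on b J"
  proof (rule independent_family_card_le(1)[OF J])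
    fix c j assume "(\<Sum>j\<in>J. konst (c j) * b j) = 0" "j \<in> J"
    with ind[of c j] fs.subspace_0[OF U] show "c j = 0" by (simp only:)
  qed
  show ?thesis unfolding qdim_def set_eq
  proof (rule Least_equality)
    have "V \<subseteq> {s + u |s u. s \<in> fs.span (b ` J) \<and> u \<in> U}" using spanning by blast
    with J bV card_image[OF injb]
    show "\<exists>S. finite S \<and> card S = card J \<and> S \<subseteq> V \<and> V \<subseteq> {s + u |s u. s \<in> fs.span S \<and> u \<in> U}"
      by (intro exI[of _ "b ` J"]) simp
  next
    fix n assume "\<exists>S. finite S \<and> card S = n \<and> S \<subseteq> V \<and> V \<subseteq> {s + u |s u. s \<in> fs.span S \<and> u \<in> U}"
    then obtain S where S: "finite S" "card S = n" "V \<subseteq> {s + u |s u. s \<in> fs.span S \<and> u \<in> U}" by blast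
    \<comment> \<open>The splitting need not be unique, so one pair of components is chosen for each
      \<open>j\<close>.\<close>
    have "\<forall>j\<in>J. \<exists>p. fst p \<in> fs.span S \<and> snd p \<in> U \<and> b j = fst p + snd p"
      using S(3) bV by fastforce
    from bchoice[OF this] obtain p where
      p: "\<And>j. j \<in> J \<Longrightarrow> fst (p j) \<in> fs.span S \<and> snd (p j) \<in> U \<and> b j = fst (p j) + snd (p j)"
      by blast
    have "card J \<le> card S"
    proof (rule independent_family_card_le(2)[OF J _ S(1), of "\<lambda>j. fst (p j)"])
      fix c j assume 0: "(\<Sum>j\<in>J. konst (c j) * fst (p j)) = 0" and j: "j \<in> J"
      have "(\<Sum>j\<in>J. konst (c j) * b j) = (\<Sum>j\<in>J. konst (c j) * fst (p j)) + (\<Sum>j\<in>J. konst (c j) * snd (p j))"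
        unfolding sum.distrib[symmetric] using p by (intro sum.cong refl) (simp only: distrib_left)
      also have "\<dots> = (\<Sum>j\<in>J. konst (c j) * snd (p j))" by (simp only: 0 add_0_left)
      also have "\<dots> \<in> U" using p by (intro fs.subspace_sum[OF U] fs.subspace_scale[OF U]) blast
      finally show "c j = 0" using ind j by blast
    next
      show "(\<lambda>j. fst (p j)) ` J \<subseteq> fs.span S" using p by blast
    qed
    with S(2) show "card J \<le> n" by simp
  qed
qed

section \<open>Bihomogeneous functions and extraction of components\<close>

lemma bihom_mult: "bihom i j f \<Longrightarrow> bihom i' j' g \<Longrightarrow> bihom (i + i') (j + j') (f * g)"
  unfolding bihom_def times_fun_apply power_add by (simp only: ac_simps) simp

lemma bihom_1: "bihom 0 0 1"
  by (simp add: bihom_def)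

lemma bihom_power: "bihom i j f \<Longrightarrow> bihom (n * i) (n * j) (f ^ n)"
  by (induction n) (auto simp: bihom_1 intro: bihom_mult)

lemma bihom_add: "bihom i j f \<Longrightarrow> bihom i j g \<Longrightarrow> bihom i j (f + g)"
  and bihom_diff: "bihom i j f \<Longrightarrow> bihom i j g \<Longrightarrow> bihom i j (f - g)"
  and bihom_scale: "bihom i j f \<Longrightarrow> bihom i j (konst c * f)"
  and bihom_0: "bihom i j 0"
  by (simp_all add: bihom_def algebra_simps)

lemma subspace_bihom: "fs.subspace {f. bihom i j f}"
  by (rule fs.subspaceI) (simp_all add: bihom_0 bihom_add bihom_scale)

lemma bihom_mono: "bihom (a + b) (c + d) (mono (a,b,c,d))"
  by (simp add: bihom_def mono_def power_mult_distrib power_add)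

lemma bihom_coords: "bihom 1 0 zx" "bihom 1 0 wx" "bihom 0 1 zy" "bihom 0 1 wy"
  by (simp_all add: bihom_def zx_def wx_def zy_def wy_def algebra_simps)

lemma bihom_Delta: "bihom 1 1 Delta"
  unfolding Delta_def
  using bihom_mult[OF bihom_coords(1,4)] bihom_mult[OF bihom_coords(2,3)] by (simp add: bihom_diff)

lemma bihom_galt: "bihom (k - i) i (galt k i)"
  unfolding galt_def
  using bihom_mult[OF bihom_power[OF bihom_coords(1)] bihom_power[OF bihom_coords(3)], of "k - i" i]
    bihom_mult[OF bihom_power[OF bihom_coords(2)] bihom_power[OF bihom_coords(4)], of "k - i" i]
  by (simp add: bihom_diff)

lemma bihom_Gpow: "s \<le> j * k \<Longrightarrow> bihom (j * k - s) s (Gpow k j s)"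
proof (induction j arbitrary: s)
  case 0
  then have "s = 0" by simp
  with bihom_1 show ?case by (simp only: Gpow.simps mult_0 diff_0_eq_0)
next
  case (Suc j)
  define l where "l = min s k"
  have l: "l \<le> k" "s - l \<le> j * k" "l \<le> s" using Suc.prems by (auto simp: l_def)
  have "bihom ((k - l) + (j * k - (s - l))) (l + (s - l)) (galt k l * Gpow k j (s - l))"
    using l by (intro bihom_mult bihom_galt Suc.IH)
  moreover have "(k - l) + (j * k - (s - l)) = Suc j * k - s" "l + (s - l) = s" using l by auto
  ultimately show ?case by (simp only: Gpow.simps flip: l_def)
qed

text \<open>An identity valid for all complex \<open>s\<close> is an identity of polynomials, so
  coefficients of \<open>s ^ p\<close> can be compared.\<close>

lemma power_coeff_extract:
  fixes a :: "'t \<Rightarrow> complex"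
  assumes T: "finite T" and eq: "\<And>s. (\<Sum>t\<in>T. s ^ d t * a t) = s ^ p * b"
  shows "(\<Sum>t | t \<in> T \<and> d t = p. a t) = b"
proof -
  have "poly (\<Sum>t\<in>T. monom (a t) (d t)) = poly (monom b p)"
    using eq by (intro ext) (simp add: poly_sum poly_monom mult.commute)
  then have "coeff (\<Sum>t\<in>T. monom (a t) (d t)) p = coeff (monom b p) p"
    by (simp add: poly_eq_poly_eq_iff)
  then have "(\<Sum>t\<in>T. if d t = p then a t else 0) = b"
    by (simp add: coeff_sum)
  then show ?thesis using T by (simp add: sum.inter_filter)
qed

text \<open>Scaling \<open>x\<close> by \<open>s\<close> and \<open>y\<close> by \<open>u\<close>,
  coefficients are compared first in \<open>s\<close>, then in \<open>u\<close>; terms of other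
  bidegrees cancel in total.\<close>

lemma bihom_extract:
  assumes T: "finite T" and f: "bihom p q (\<Sum>t\<in>T. h t)"
    and h: "\<And>t. t \<in> T \<Longrightarrow> bihom (dp t) (dq t) (h t)"
  shows "(\<Sum>t\<in>T. h t) = (\<Sum>t | t \<in> T \<and> dp t = p \<and> dq t = q. h t)"
proof
  fix z :: pt
  obtain x1 x2 y1 y2 where z: "z = ((x1,x2),(y1,y2))" by (metis surj_pair)
  define F where "F = (\<Sum>t\<in>T. h t)"
  have eq: "(\<Sum>t\<in>T. s ^ dp t * (u ^ dq t * h t z)) = s ^ p * (u ^ q * F z)" for s u
  proof -
    have "(\<Sum>t\<in>T. s ^ dp t * (u ^ dq t * h t z)) = (\<Sum>t\<in>T. h t ((s*x1, s*x2), (u*y1, u*y2)))"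
      using h by (intro sum.cong refl) (simp add: bihom_def z mult.assoc)
    also have "\<dots> = F ((s*x1, s*x2), (u*y1, u*y2))" by (simp add: F_def sum_fun_apply)
    also have "\<dots> = s ^ p * (u ^ q * F z)" using f by (simp add: F_def[symmetric] bihom_def z mult.assoc)
    finally show ?thesis .
  qed
  have "(\<Sum>t | t \<in> T \<and> dp t = p. u ^ dq t * h t z) = u ^ q * F z" for u
    using T eq by (rule power_coeff_extract)
  from power_coeff_extract[OF _ this] T
  have "(\<Sum>t | t \<in> {t \<in> T. dp t = p} \<and> dq t = q. h t z) = F z" by simp
  then show "(\<Sum>t\<in>T. h t) z = (\<Sum>t | t \<in> T \<and> dp t = p \<and> dq t = q. h t) z"
    by (simp add: F_def sum_fun_apply conj_assoc)
qed

lemma span_image_bihom: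
  assumes f: "f \<in> fs.span (h ` I)" "bihom p q f"
    and h: "\<And>t. t \<in> I \<Longrightarrow> bihom (dp t) (dq t) (h t)"
  shows "f \<in> fs.span (h ` {t \<in> I. dp t = p \<and> dq t = q})"
proof -
  from f(1) obtain T r where T: "finite T" "T \<subseteq> h ` I" and fT: "f = (\<Sum>x\<in>T. konst (r x) * x)"
    unfolding fs.span_explicit by blast
  \<comment> \<open>Bidegrees are attached to indices and \<open>h\<close> need not be injective, so
    one index is chosen for each function in \<open>T\<close>.\<close>
  define g where "g = inv_into I h"
  have g: "g x \<in> I" "h (g x) = x" if "x \<in> T" for x
    using that T(2) by (auto simp: g_def inv_into_into f_inv_into_f)
  have "f = (\<Sum>x | x \<in> T \<and> dp (g x) = p \<and> dq (g x) = q. konst (r x) * x)"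
    unfolding fT
  proof (rule bihom_extract[OF T(1)])
    show "bihom p q (\<Sum>x\<in>T. konst (r x) * x)" using f(2) fT by simp
    show "bihom (dp (g x)) (dq (g x)) (konst (r x) * x)" if "x \<in> T" for x
      using h[OF g(1)[OF that]] g(2)[OF that] by (auto intro: bihom_scale)
  qed
  also have "\<dots> \<in> fs.span (h ` {t \<in> I. dp t = p \<and> dq t = q})"
  proof (intro fs.span_sum fs.span_scale fs.span_base)
    fix x assume "x \<in> {x. x \<in> T \<and> dp (g x) = p \<and> dq (g x) = q}"
    then show "x \<in> h ` {t \<in> I. dp t = p \<and> dq t = q}"
      using g by (intro image_eqI[of _ _ "g x"]) auto
  qed
  finally show ?thesis .
qed

text \<open>The span of the monomial multiples is itself an ideal, because products of monomials are
  monomials.\<close>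

lemma gen_ideal_subset_span: "gen_ideal S \<subseteq> fs.span {mono e * g | e g. g \<in> S}"
proof (rule gen_ideal_least)
  show "poly_ideal (fs.span {mono e * g | e g. g \<in> S})"
    unfolding poly_ideal_def
  proof (intro conjI ballI allI impI)
    fix r f assume "poly_fun r" and f: "f \<in> fs.span {mono e * g | e g. g \<in> S}"
    then have r: "r \<in> fs.span (range mono)" by (simp add: poly_fun_iff_span)
    show "r * f \<in> fs.span {mono e * g | e g. g \<in> S}"
    proof (rule span_mult[OF r f fs.subspace_span])
      fix s t assume "s \<in> range mono" "t \<in> {mono e * g | e g. g \<in> S}"
      then obtain a b c d a' b' c' d' g where
        "s = mono (a,b,c,d)" "t = mono (a',b',c',d') * g" "g \<in> S" by auto
      then have "s * t = mono (a+a',b+b',c+c',d+d') * g" "g \<in> S"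
        by (simp_all only: mono_mult flip: mult.assoc)
      then show "s * t \<in> fs.span {mono e * g | e g. g \<in> S}" by (intro fs.span_base) blast
    qed
  qed (simp_all add: fs.span_zero fs.span_add)
  show "S \<subseteq> fs.span {mono e * g | e g. g \<in> S}"
  proof
    fix g assume "g \<in> S"
    moreover have "g = mono (0,0,0,0) * g" by (simp add: fun_eq_iff mono_def)
    ultimately show "g \<in> fs.span {mono e * g | e g. g \<in> S}" by (intro fs.span_base) blast
  qed
qed

text \<open>The variable contributed by \<open>max_ideal\<close> keeps the monomial coefficient
  nonconstant, which is what makes the generators minimal later.\<close>

lemma max_ideal_prod_subset_span:
  "ideal_prod max_ideal (gen_ideal S) \<subseteq> fs.span {mono e * g | e g. e \<noteq> (0,0,0,0) \<and> g \<in> S}"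
proof -
  let ?X = "{mono (1,0,0,0), mono (0,1,0,0), mono (0,0,1,0), mono (0,0,0,1)}"
  let ?S = "{x * g | x g. x \<in> ?X \<and> g \<in> S}"
  have "ideal_prod max_ideal (gen_ideal S) \<subseteq> gen_ideal ?S"
    unfolding max_ideal_def
    by (rule ideal_prod_gen_ideal_least[OF poly_ideal_gen_ideal], rule gen_ideal_base) blast
  also have "\<dots> \<subseteq> fs.span {mono e * h | e h. h \<in> ?S}" by (rule gen_ideal_subset_span)
  also have "\<dots> \<subseteq> fs.span {mono e * g | e g. e \<noteq> (0,0,0,0) \<and> g \<in> S}"
  proof (rule fs.span_mono, rule subsetI)
    fix f assume "f \<in> {mono e * h | e h. h \<in> ?S}"
    then obtain a b c d x g where f: "f = mono (a,b,c,d) * (x * g)" and x: "x \<in> ?X" and g: "g \<in> S"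
      by auto
    have "\<exists>e. e \<noteq> (0,0,0,0) \<and> mono (a,b,c,d) * x = mono e"
      using x by (elim insertE emptyE)
        (simp only: mono_mult, rule exI, rule conjI[rotated], rule refl, simp)+
    with f g show "f \<in> {mono e * g | e g. e \<noteq> (0,0,0,0) \<and> g \<in> S}"
      by (metis (mono_tags, lifting) mem_Collect_eq mult.assoc)
  qed
  finally show ?thesis .
qed

lemma mono_in_max_ideal:
  assumes "e \<noteq> (0,0,0,0)" shows "mono e \<in> max_ideal"
proof -
  let ?X = "{mono (1,0,0,0), mono (0,1,0,0), mono (0,0,1,0), mono (0,0,0,1)}"
  have m: "mono e' * x \<in> max_ideal" if "x \<in> ?X" for e' x
    unfolding max_ideal_def using that
    by (intro poly_ideal_mult[OF poly_ideal_gen_ideal] poly_fun_mono gen_ideal_base)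
  obtain a b c d where e: "e = (a,b,c,d)" by (metis surj_pair)
  consider a' where "a = a' + 1" | b' where "b = b' + 1" | c' where "c = c' + 1" | d' where "d = d' + 1"
    using assms e by (metis Suc_eq_plus1 not0_implies_Suc)
  then show ?thesis
  proof cases
    case 1
    with m[of "mono (1,0,0,0)" "(a',b,c,d)"] show ?thesis by (simp add: e mono_mult)
  next
    case 2
    with m[of "mono (0,1,0,0)" "(a,b',c,d)"] show ?thesis by (simp add: e mono_mult)
  next
    case 3
    with m[of "mono (0,0,1,0)" "(a,b,c',d)"] show ?thesis by (simp add: e mono_mult)
  next
    case 4
    with m[of "mono (0,0,0,1)" "(a,b,c,d')"] show ?thesis by (simp add: e mono_mult)
  qed
qed

section \<open>Minimality of the generators\<close>

definition pow_gen :: "nat \<Rightarrow> nat \<Rightarrow> nat \<Rightarrow> nat \<Rightarrow> pt \<Rightarrow> complex" where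
  "pow_gen k m j s = Delta ^ (m - j) * Gpow k j s"

lemma bihom_pow_gen:
  "s \<le> j * k \<Longrightarrow> bihom (m - j + (j * k - s)) (m - j + s) (pow_gen k m j s)"
  unfolding pow_gen_def
  using bihom_mult[OF bihom_power[OF bihom_Delta] bihom_Gpow, of s j k "m - j"] by simp

type_synonym pow_index = "(nat \<times> nat \<times> nat \<times> nat) \<times> nat \<times> nat"

definition pow_term :: "nat \<Rightarrow> nat \<Rightarrow> pow_index \<Rightarrow> pt \<Rightarrow> complex" where
  "pow_term k m = (\<lambda>(e, j, s). mono e * pow_gen k m j s)"

definition pow_indices :: "nat \<Rightarrow> nat \<Rightarrow> pow_index set" where
  "pow_indices k m = {(e, j, s). j \<le> m \<and> s \<le> j * k}"

definition xdeg :: "nat \<Rightarrow> nat \<Rightarrow> pow_index \<Rightarrow> nat" where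
  "xdeg k m = (\<lambda>((a,b,c,d), j, s). a + b + (m - j + (j * k - s)))"

definition ydeg :: "nat \<Rightarrow> nat \<Rightarrow> pow_index \<Rightarrow> nat" where
  "ydeg k m = (\<lambda>((a,b,c,d), j, s). c + d + (m - j + s))"

lemma bihom_pow_term: "t \<in> pow_indices k m \<Longrightarrow> bihom (xdeg k m t) (ydeg k m t) (pow_term k m t)"
  by (auto simp: pow_indices_def xdeg_def ydeg_def pow_term_def intro!: bihom_mult bihom_mono bihom_pow_gen)

lemma pow_gens_eq: "pow_gens k m = {pow_gen k m j s | j s. j \<le> m \<and> s \<le> j * k}"
  by (simp add: pow_gens_def pow_gen_def)

lemma gen_ideal_pow_gens_subset: "gen_ideal (pow_gens k m) \<subseteq> fs.span (pow_term k m ` pow_indices k m)"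
proof -
  have "{mono e * g | e g. g \<in> pow_gens k m} \<subseteq> pow_term k m ` pow_indices k m"
  proof
    fix f assume "f \<in> {mono e * g | e g. g \<in> pow_gens k m}"
    then obtain e j s where "f = mono e * pow_gen k m j s" "j \<le> m" "s \<le> j * k"
      unfolding pow_gens_eq by blast
    then show "f \<in> pow_term k m ` pow_indices k m"
      by (intro image_eqI[of _ _ "(e, j, s)"]) (simp_all add: pow_term_def pow_indices_def)
  qed
  from subset_trans[OF gen_ideal_subset_span fs.span_mono[OF this]] show ?thesis .
qed

lemma max_ideal_prod_pow_gens_subset:
  "ideal_prod max_ideal (gen_ideal (pow_gens k m))
    \<subseteq> fs.span (pow_term k m ` {t \<in> pow_indices k m. fst t \<noteq> (0,0,0,0)})"
proof -
  have "{mono e * g | e g. e \<noteq> (0,0,0,0) \<and> g \<in> pow_gens k m}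
      \<subseteq> pow_term k m ` {t \<in> pow_indices k m. fst t \<noteq> (0,0,0,0)}"
  proof
    fix f assume "f \<in> {mono e * g | e g. e \<noteq> (0,0,0,0) \<and> g \<in> pow_gens k m}"
    then obtain e j s where "f = mono e * pow_gen k m j s" "e \<noteq> (0,0,0,0)" "j \<le> m" "s \<le> j * k"
      unfolding pow_gens_eq by blast
    then show "f \<in> pow_term k m ` {t \<in> pow_indices k m. fst t \<noteq> (0,0,0,0)}"
      by (intro image_eqI[of _ _ "(e, j, s)"]) (simp_all add: pow_term_def pow_indices_def)
  qed
  from subset_trans[OF max_ideal_prod_subset_span fs.span_mono[OF this]] show ?thesis .
qed

lemma pow_term_in_max_ideal_prod:
  assumes "t \<in> pow_indices k m" "fst t \<noteq> (0,0,0,0)"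
  shows "pow_term k m t \<in> ideal_prod max_ideal (gen_ideal (pow_gens k m))"
proof -
  obtain e j s where t: "t = (e, j, s)" by (metis surj_pair)
  have "mono e * pow_gen k m j s \<in> ideal_prod max_ideal (gen_ideal (pow_gens k m))"
    using assms by (intro ideal_prod_mult mono_in_max_ideal gen_ideal_base)
      (auto simp: t pow_gens_eq pow_indices_def)
  then show ?thesis by (simp add: t pow_term_def)
qed

text \<open>A curve that meets the hypersurface \<open>Delta = 0\<close> transversally, at a point where no
  \<open>Gpow k j s\<close> vanishes.\<close>

definition curve :: "complex \<Rightarrow> pt" where
  "curve u = (((3 + u) / 2, (1 + u) / (2 * \<i>)), (3 / 2, 1 / (2 * \<i>)))"

lemma coords_curve: "zx (curve u) = 2 + u" "wx (curve u) = 1" "zy (curve u) = 2" "wy (curve u) = 1"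
  by (simp_all add: zx_def wx_def zy_def wy_def curve_def field_simps)

lemma Delta_curve: "Delta (curve u) = u"
  by (simp add: Delta_def coords_curve)

text \<open>At \<open>curve 0\<close> both \<open>z\<close> coordinates are 2 and both
  \<open>w\<close> coordinates are 1, so every factor equals \<open>2 ^ k - 1\<close>.\<close>

lemma Gpow_curve_0:
  assumes "k > 0" shows "Gpow k j s (curve 0) \<noteq> 0"
proof (induction j arbitrary: s)
  case (Suc j)
  have "galt k i (curve 0) \<noteq> 0" if "i \<le> k" for i
  proof -
    have "galt k i (curve 0) = 2 ^ k - 1"
      using that by (simp add: galt_def power_fun_apply coords_curve flip: power_add)
    moreover have "norm ((2::complex) ^ k) > 1" using assms by (simp add: norm_power)
    ultimately show ?thesis by auto
  qed
  with Suc show ?case by simp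
qed simp

lemma isCont_poly_fun_curve:
  assumes "poly_fun f" shows "isCont (\<lambda>u. f (curve u)) u0"
  using assms unfolding poly_fun_iff_span
proof (induction rule: fs.span_induct_alt)
  case (step c x y)
  then obtain a b c' d where "x = mono (a,b,c',d)" by auto
  with step show ?case
    by (auto simp: mono_def curve_def intro!: continuous_intros)
qed simp

text \<open>Along the curve \<open>Delta\<close> equals \<open>u\<close>, so
  \<open>Delta ^ n\<close> cancels for \<open>u \<noteq> 0\<close>, and continuity gives the value
  at \<open>u = 0\<close>. This takes the place of a divisibility argument in the polynomial
  ring.\<close>

lemma Delta_power_division:
  assumes "poly_fun g" "poly_fun r" and eq: "Delta ^ n * g = Delta ^ Suc n * r"
  shows "g (curve 0) = 0"
proof -
  have "g (curve u) = u * r (curve u)" if "u \<noteq> 0" for u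
  proof -
    have "(Delta ^ n * g) (curve u) = (Delta ^ Suc n * r) (curve u)" by (simp only: eq)
    with that show ?thesis by (simp add: power_fun_apply Delta_curve)
  qed
  then have ev: "eventually (\<lambda>u. g (curve u) = u * r (curve u)) (at 0)"
    by (auto simp: eventually_at_filter)
  have "((\<lambda>u. u * r (curve u)) \<longlongrightarrow> 0 * r (curve 0)) (at 0)"
    using isCont_poly_fun_curve[OF assms(2), of 0] by (intro tendsto_intros) (simp add: isCont_def)
  then have "((\<lambda>u. g (curve u)) \<longlongrightarrow> 0) (at 0)" using ev by (simp add: tendsto_cong)
  moreover have "((\<lambda>u. g (curve u)) \<longlongrightarrow> g (curve 0)) (at 0)"
    using isCont_poly_fun_curve[OF assms(1), of 0] by (simp add: isCont_def)
  ultimately show ?thesis by (rule LIM_unique[symmetric])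
qed

text \<open>Those \<open>j\<close> for which some \<open>pow_gen k m j s\<close> with
  \<open>s \<le> j * k\<close> has bidegree \<open>(p, q)\<close>: given the total degree,
  \<open>m - j \<le> p\<close> expresses \<open>s \<le> j * k\<close>. As
  \<open>p + q = 2 * m + j * (k - 2)\<close>, several \<open>j\<close> can occur only for
  \<open>k = 2\<close>.\<close>

definition basis_index :: "nat \<Rightarrow> nat \<Rightarrow> nat \<Rightarrow> nat \<Rightarrow> nat set" where
  "basis_index k m p q = {j. j \<le> m \<and> m - j \<le> p \<and> m - j \<le> q \<and> p + q = 2 * (m - j) + j * k}"

text \<open>The \<open>y\<close>-degree \<open>q\<close> forces the index sum \<open>s = q - (m - j)\<close>.\<close>

definition basis_elem :: "nat \<Rightarrow> nat \<Rightarrow> nat \<Rightarrow> nat \<Rightarrow> pt \<Rightarrow> complex" where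
  "basis_elem k m q j = pow_gen k m j (q - (m - j))"

text \<open>A generator of index \<open>j\<close> has degree \<open>2 * m + j * (k - 2)\<close>, so
  a nonconstant monomial in front forces \<open>j < J\<close> and thereby a higher power of
  \<open>Delta\<close>. For \<open>k = 2\<close> all generators have degree \<open>2 * m\<close> and
  no such term exists.\<close>

lemma pow_term_multiple_Delta:
  assumes "k \<ge> 2" "t \<in> pow_indices k m" "fst t \<noteq> (0,0,0,0)"
    and "J \<le> m" "xdeg k m t + ydeg k m t = 2 * (m - J) + J * k"
  shows "\<exists>r. poly_fun r \<and> pow_term k m t = Delta ^ Suc (m - J) * r"
proof -
  obtain a b c d j s where t: "t = ((a,b,c,d), j, s)" by (metis surj_pair)
  \<comment> \<open>Writing \<open>l\<close> for \<open>k - 2\<close> avoids truncated subtraction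
    in the degree formula.\<close>
  obtain l where k: "k = l + 2" using assms(1) by (metis le_add_diff_inverse2)
  have j: "j \<le> m" "s \<le> j * k" using assms(2) by (auto simp: t pow_indices_def)
  have "a + b + c + d + (2 * (m - j) + j * k) = 2 * (m - J) + J * k"
    using assms(5) j by (simp add: t xdeg_def ydeg_def)
  moreover have "a + b + c + d > 0" using assms(3) by (auto simp: t)
  ultimately have "2 * (m - j) + j * k < 2 * (m - J) + J * k" by linarith
  moreover have "2 * (m - i) + i * k = 2 * m + i * l" if "i \<le> m" for i
    using that by (simp add: k algebra_simps)
  ultimately have "j * l < J * l" using j(1) assms(4) by simp
  then have "j < J" by simp
  then obtain n where n: "m - j = Suc (m - J) + n" using assms(4) by (metis diff_less_mono2 less_iff_Suc_add add_Suc less_le_trans)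
  have "pow_term k m t = Delta ^ Suc (m - J) * (mono (a,b,c,d) * Delta ^ n * Gpow k j s)"
    unfolding t pow_term_def case_prod_conv pow_gen_def unfolding n power_add by (simp only: ac_simps)
  then show ?thesis
    by (intro exI[of _ "mono (a,b,c,d) * Delta ^ n * Gpow k j s"])
      (auto intro!: poly_fun_mult poly_fun_mono poly_fun_power poly_fun_Delta poly_fun_Gpow)
qed

lemma basis_elem_independent:
  assumes k: "k \<ge> 2"
    and u: "(\<Sum>j\<in>basis_index k m p q. konst (c j) * basis_elem k m q j)
       \<in> {f \<in> ideal_prod max_ideal (gen_ideal (pow_gens k m)). bihom p q f}" (is "?u \<in> _")
    and j: "j \<in> basis_index k m p q"
  shows "c j = 0"
proof (rule ccontr)
  assume "c j \<noteq> 0"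
  let ?J = "basis_index k m p q"
  have fin: "finite ?J" by (rule finite_subset[of _ "{..m}"]) (auto simp: basis_index_def)
  define N where "N = {j \<in> ?J. c j \<noteq> 0}"
  \<comment> \<open>The largest index carries the smallest power of \<open>Delta\<close>, so modulo
    \<open>Delta ^ Suc (m - j0)\<close> only its term can survive.\<close>
  define j0 where "j0 = Max N"
  have N: "finite N" "N \<noteq> {}" using fin j \<open>c j \<noteq> 0\<close> by (auto simp: N_def)
  have j0: "j0 \<in> ?J" "c j0 \<noteq> 0" using Max_in[OF N] by (auto simp: j0_def N_def)
  have max: "i \<le> j0" if "i \<in> ?J" "c i \<noteq> 0" for i using that N by (auto simp: j0_def N_def)
  define K where "K = {Delta ^ Suc (m - j0) * r | r. poly_fun r}"
  \<comment> \<open>The zeroth power of any ideal is the whole polynomial ring, which provides the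
    ideal whose multiples by the power of \<open>Delta\<close> form \<open>K\<close>.\<close>
  have K: "poly_ideal K"
    unfolding K_def using poly_ideal_image_mult[OF poly_ideal_ideal_pow[of "{}" 0], of "Delta ^ Suc (m - j0)"]
    by simp
  have jm: "j0 \<le> m" "p + q = 2 * (m - j0) + j0 * k" using j0 by (auto simp: basis_index_def)
  have "?u \<in> fs.span (pow_term k m ` {t \<in> {t \<in> pow_indices k m. fst t \<noteq> (0,0,0,0)}. xdeg k m t = p \<and> ydeg k m t = q})"
    using u max_ideal_prod_pow_gens_subset by (intro span_image_bihom bihom_pow_term) auto
  also have "\<dots> \<subseteq> K"
  proof (rule fs.span_minimal[OF _ subspace_poly_ideal[OF K]], rule image_subsetI)
    fix t assume "t \<in> {t \<in> {t \<in> pow_indices k m. fst t \<noteq> (0,0,0,0)}. xdeg k m t = p \<and> ydeg k m t = q}"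
    then show "pow_term k m t \<in> K"
      unfolding K_def using pow_term_multiple_Delta[OF k, of t m j0] jm by auto
  qed
  finally have uK: "?u \<in> K" .
  have rest: "konst (c i) * basis_elem k m q i \<in> K" if i: "i \<in> ?J - {j0}" for i
  proof (cases "c i = 0")
    case True
    then have "konst (c i) * basis_elem k m q i = 0" by (simp add: fun_eq_iff)
    with poly_ideal_0[OF K] show ?thesis by (simp only:)
  next
    case False
    with max[of i] i have "i < j0" by auto
    then obtain n where n: "m - i = Suc (m - j0) + n"
      using jm(1) by (metis diff_less_mono2 less_iff_Suc_add add_Suc less_le_trans)
    have "konst (c i) * basis_elem k m q i
        = Delta ^ Suc (m - j0) * (konst (c i) * Delta ^ n * Gpow k i (q - (m - i)))"
      unfolding basis_elem_def pow_gen_def unfolding n power_add by (simp only: ac_simps)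
    moreover have "poly_fun (konst (c i) * Delta ^ n * Gpow k i (q - (m - i)))"
      by (intro poly_fun_mult poly_fun_konst poly_fun_power poly_fun_Delta poly_fun_Gpow)
    ultimately show ?thesis unfolding K_def by blast
  qed
  have "konst (c j0) * basis_elem k m q j0 = ?u - (\<Sum>i\<in>?J - {j0}. konst (c i) * basis_elem k m q i)"
    using sum.remove[OF fin j0(1), of "\<lambda>i. konst (c i) * basis_elem k m q i"] by (simp only: add_diff_cancel_right')
  also have "\<dots> \<in> K" by (rule poly_ideal_diff[OF K uK poly_ideal_sum[OF K rest]])
  finally obtain r where r: "poly_fun r"
      "konst (c j0) * basis_elem k m q j0 = Delta ^ Suc (m - j0) * r"
    unfolding K_def by blast
  have "Delta ^ (m - j0) * (konst (c j0) * Gpow k j0 (q - (m - j0))) = Delta ^ Suc (m - j0) * r"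
    using r(2) unfolding basis_elem_def pow_gen_def by (simp only: mult.left_commute)
  from Delta_power_division[OF _ r(1) this] have "c j0 * Gpow k j0 (q - (m - j0)) (curve 0) = 0"
    by (simp add: poly_fun_mult poly_fun_konst poly_fun_Gpow)
  with j0(2) Gpow_curve_0[of k] k show False by simp
qed

text \<open>In bidegree \<open>(p, q)\<close> the ideal is spanned by monomial multiples of
  generators; those with a nonconstant monomial vanish in the quotient, and the others are the
  \<open>basis_elem\<close>, independent by \<open>basis_elem_independent\<close>.\<close>

lemma Mdim_dihedral:
  assumes k: "k \<ge> 2"
  shows "Mdim (dihedral k) m p q = card (basis_index k m p q)"
proof -
  let ?J = "basis_index k m p q"
  let ?A = "gen_ideal (pow_gens k m)"
  have A: "ideal_pow (alt_ideal (dihedral k)) m = ?A"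
    using k by (simp add: alt_ideal_dihedral ideal_pow_alt_gens)
  show ?thesis unfolding Mdim_def A
  proof (rule qdim_eq_card)
    show "fs.subspace {f \<in> ideal_prod max_ideal ?A. bihom p q f}"
      using fs.subspace_inter[OF subspace_poly_ideal[OF poly_ideal_ideal_prod] subspace_bihom]
      by (simp add: Int_def)
    show "finite ?J" by (rule finite_subset[of _ "{..m}"]) (auto simp: basis_index_def)
    show "basis_elem k m q ` ?J \<subseteq> {f \<in> ?A. bihom p q f}"
    proof (rule image_subsetI)
      fix j assume j: "j \<in> ?J"
      let ?s = "q - (m - j)"
      have s: "?s \<le> j * k" "m - j + (j * k - ?s) = p" "m - j + ?s = q" "j \<le> m"
        using j by (auto simp: basis_index_def)
      have "basis_elem k m q j \<in> ?A"
        unfolding basis_elem_def pow_gens_eq using s by (intro gen_ideal_base) blast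
      moreover have "bihom p q (basis_elem k m q j)"
        unfolding basis_elem_def using bihom_pow_gen[OF s(1), of m] by (simp only: s)
      ultimately show "basis_elem k m q j \<in> {f \<in> ?A. bihom p q f}" by blast
    qed
    show "c j = 0" if "(\<Sum>j\<in>?J. konst (c j) * basis_elem k m q j) \<in> {f \<in> ideal_prod max_ideal ?A. bihom p q f}"
      "j \<in> ?J" for c j
      using basis_elem_independent[OF k that] .
    fix f assume "f \<in> {f \<in> ?A. bihom p q f}"
    then have "f \<in> fs.span (pow_term k m ` pow_indices k m)" "bihom p q f"
      using gen_ideal_pow_gens_subset by auto
    then have "f \<in> fs.span (pow_term k m ` {t \<in> pow_indices k m. xdeg k m t = p \<and> ydeg k m t = q})"
      by (rule span_image_bihom) (rule bihom_pow_term)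
    also have "\<dots> \<subseteq> fs.span (basis_elem k m q ` ?J \<union> {f \<in> ideal_prod max_ideal ?A. bihom p q f})"
    proof (rule fs.span_mono, rule image_subsetI)
      fix t assume "t \<in> {t \<in> pow_indices k m. xdeg k m t = p \<and> ydeg k m t = q}"
      then have t: "t \<in> pow_indices k m" "xdeg k m t = p" "ydeg k m t = q" by auto
      show "pow_term k m t \<in> basis_elem k m q ` ?J \<union> {f \<in> ideal_prod max_ideal ?A. bihom p q f}"
      proof (cases "fst t = (0,0,0,0)")
        case True
        then obtain j s where t0: "t = ((0,0,0,0), j, s)" by (metis prod.collapse)
        have js: "j \<le> m" "s \<le> j * k" "m - j + (j * k - s) = p" "m - j + s = q"
          using t by (auto simp: t0 pow_indices_def xdeg_def ydeg_def)
        have "mono (0,0,0,0) = 1" by (simp add: fun_eq_iff mono_def)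
        then have "pow_term k m t = basis_elem k m q j"
          using js(4) by (auto simp: t0 pow_term_def basis_elem_def)
        moreover have "j \<in> ?J" using js by (auto simp: basis_index_def)
        ultimately show ?thesis by blast
      next
        case False
        with pow_term_in_max_ideal_prod[OF t(1)] bihom_pow_term[OF t(1)] t(2,3) show ?thesis by blast
      qed
    qed
    finally have "f \<in> fs.span (basis_elem k m q ` ?J \<union> {f \<in> ideal_prod max_ideal ?A. bihom p q f})" .
    \<comment> \<open>This set is already a subspace, so the span of the union splits into a
      combination of basis elements and a member of the set.\<close>
    moreover have "fs.span {f \<in> ideal_prod max_ideal ?A. bihom p q f} = {f \<in> ideal_prod max_ideal ?A. bihom p q f}"
      using fs.subspace_inter[OF subspace_poly_ideal[OF poly_ideal_ideal_prod] subspace_bihom]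
      by (simp add: Int_def fs.span_eq_iff)
    ultimately show "\<exists>s\<in>fs.span (basis_elem k m q ` ?J).
        \<exists>u\<in>{f \<in> ideal_prod max_ideal ?A. bihom p q f}. f = s + u"
      unfolding fs.span_Un by auto
  qed
qed

section \<open>Coefficients of the right-hand side\<close>

text \<open>The ring has no zero divisors and \<open>qv - tv\<close> is nonzero, so the quotient is
  unique and the factorization of \<open>qv ^ n - tv ^ n\<close> supplies it.\<close>

lemma qt_int_eq: "qt_int n = (\<Sum>i<n. tv ^ (n - Suc i) * qv ^ i)"
proof -
  have "qv - tv \<noteq> 0"
  proof
    assume "qv - tv = 0"
    then have "coeff qv 1 = coeff tv 1" by simp
    then show False by (simp add: qv_def tv_def)
  qed
  then have "P = (\<Sum>i<n. tv ^ (n - Suc i) * qv ^ i)" if "(qv - tv) * P = qv ^ n - tv ^ n" for P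
    using that unfolding power_diff_sumr2 by (rule mult_left_cancel[THEN iffD1])
  then show ?thesis unfolding qt_int_def
    by (intro the_equality) (rule power_diff_sumr2[symmetric])
qed

lemma qv_tv_power: "qv ^ a * tv ^ b = monom (monom 1 b) a"
proof -
  have "qv ^ a = monom 1 a" by (simp add: qv_def monom_power)
  moreover have "tv ^ b = monom (monom 1 b) 0"
    unfolding tv_def monom_0[symmetric] monom_power by simp
  ultimately show ?thesis by (simp add: mult_monom)
qed

text \<open>Each summand \<open>j\<close> is a sum of distinct monomials, at most one of which is
  \<open>q^p t^q\<close>; it is present exactly when \<open>j\<close> belongs to
  \<open>basis_index k m p q\<close>.\<close>

lemma coeff_qt_sum:
  "coeff (coeff (\<Sum>j = 0..m. qv ^ (m - j) * tv ^ (m - j) * qt_int (j * k + 1)) p) q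
    = int (card (basis_index k m p q))"
proof -
  have summand: "qv ^ (m - j) * tv ^ (m - j) * qt_int (j * k + 1)
      = (\<Sum>i\<le>j * k. monom (monom 1 (m - j + (j * k - i))) (m - j + i))" for j
    unfolding qt_int_eq sum_distrib_left
  proof (rule sum.cong)
    fix i assume "i \<in> {..j * k}"
    have "qv ^ (m - j) * tv ^ (m - j) * (tv ^ (j * k + 1 - Suc i) * qv ^ i)
        = qv ^ (m - j + i) * tv ^ (m - j + (j * k - i))"
      by (simp add: power_add ac_simps)
    then show "qv ^ (m - j) * tv ^ (m - j) * (tv ^ (j * k + 1 - Suc i) * qv ^ i)
        = monom (monom 1 (m - j + (j * k - i))) (m - j + i)" by (simp only: qv_tv_power)
  qed auto
  have "coeff (coeff (qv ^ (m - j) * tv ^ (m - j) * qt_int (j * k + 1)) p) q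
      = (if j \<in> basis_index k m p q then 1 else 0)" if "j \<le> m" for j
  proof -
    have "coeff (coeff (qv ^ (m - j) * tv ^ (m - j) * qt_int (j * k + 1)) p) q
      = (\<Sum>i\<le>j * k. if m - j + i = p \<and> m - j + (j * k - i) = q then 1 else 0)"
      unfolding summand coeff_sum by (intro sum.cong) auto
    \<comment> \<open>The exponent of \<open>qv\<close> determines \<open>i\<close>. Here
      \<open>i\<close> counts \<open>x\<close>-degree, so it corresponds to \<open>j * k - s\<close>
      for the generator with index sum \<open>s\<close>.\<close>
    also have "\<dots> = (\<Sum>i\<le>j * k. if i = p - (m - j) then (if j \<in> basis_index k m p q then 1 else 0) else 0)"
    proof (intro sum.cong refl)
      fix i assume "i \<in> {..j * k}"
      then have "m - j + i = p \<and> m - j + (j * k - i) = q \<longleftrightarrow> i = p - (m - j) \<and> j \<in> basis_index k m p q"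
        using that unfolding basis_index_def mem_Collect_eq atMost_iff by linarith
      then show "(if m - j + i = p \<and> m - j + (j * k - i) = q then 1 else 0 :: int)
          = (if i = p - (m - j) then (if j \<in> basis_index k m p q then 1 else 0) else 0)"
        by simp
    qed
    \<comment> \<open>For \<open>j\<close> in \<open>basis_index\<close>, the condition
      \<open>m - j \<le> q\<close> keeps \<open>p - (m - j)\<close> within the range of
      summation.\<close>
    also have "\<dots> = (if j \<in> basis_index k m p q then 1 else 0)"
      by (auto simp: basis_index_def)
    finally show ?thesis .
  qed
  then have "coeff (coeff (\<Sum>j = 0..m. qv ^ (m - j) * tv ^ (m - j) * qt_int (j * k + 1)) p) q
     = (\<Sum>j = 0..m. if j \<in> basis_index k m p q then 1 else 0)"
    by (simp add: coeff_sum)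
  also have "\<dots> = int (card ({0..m} \<inter> basis_index k m p q))"
    by (simp add: sum.If_cases Int_def)
  also have "{0..m} \<inter> basis_index k m p q = basis_index k m p q"
    by (auto simp: basis_index_def)
  finally show ?thesis .
qed

theorem theorem3p15:
  fixes k m :: nat
  assumes "k \<ge> 2" and "m \<ge> 1"
  shows "\<forall>i j. int (Mdim (dihedral k) m i j) =
           coeff (coeff (\<Sum>j0 = 0..m. qv ^ (m - j0) * tv ^ (m - j0) * qt_int (j0 * k + 1)) i) j"
  using assms(1) by (simp only: Mdim_dihedral coeff_qt_sum) simp

end
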